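(* Let $\Sigma=(X,\sigma)$ be an arbitrary topological dynamical system. Then $C(X)'$ has the intersection property for ideals of $C^*(\Sigma)$; that is, $J\cap C(X)'\neq\{0\}$ for every non-zero two-sided ideal $J$ of $C^*(\Sigma)$, not necessarily closed or self-adjoint.
   Context: A topological dynamical system $\Sigma=(X,\sigma)$ consists of a compact Hausdorff space $X$ and a homeomorphism $\sigma$ of $X$. $C^*(\Sigma)=C(X)\rtimes_\alpha\mathbb{Z}$ is the $C^*$-crossed product for the automorphism $\alpha(f)=f\circ\sigma^{-1}$ of $C(X)$; it is generated by a copy of $C(X)$ and a canonical unitary $\delta$ with $\delta f\delta^*=\alpha(f)$. $C(X)'=\{a\in C^*(\Sigma): af=fa\text{ for all }f\in C(X)\}$. *)

theory Defs
  imports "HOL-Analysis.Analysis"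
begin

section \<open>Unital C*-algebras\<close>

text \<open>
  The class is built on \<^class>\<open>monoid_mult\<close> rather than \<^class>\<open>ring_1\<close>, so the zero algebra,
  where 1 = 0, is allowed. It is the crossed product over the empty space.
\<close>

class cstar_algebra = real_normed_algebra + banach + monoid_mult +
  fixes scaleC :: "complex \<Rightarrow> 'a \<Rightarrow> 'a"
    and star :: "'a \<Rightarrow> 'a"
  assumes scaleC_of_real: "scaleC (complex_of_real r) x = scaleR r x"
    and scaleC_add_right: "scaleC c (x + y) = scaleC c x + scaleC c y"
    and scaleC_add_left: "scaleC (c + d) x = scaleC c x + scaleC d x"
    and scaleC_scaleC: "scaleC c (scaleC d x) = scaleC (c * d) x"
    and scaleC_mult_left: "scaleC c x * y = scaleC c (x * y)"
    and scaleC_mult_right: "x * scaleC c y = scaleC c (x * y)"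
    and norm_scaleC: "norm (scaleC c x) = cmod c * norm x"
    and star_add: "star (x + y) = star x + star y"
    and star_scaleC: "star (scaleC c x) = scaleC (cnj c) (star x)"
    and star_mult: "star (x * y) = star y * star x"
    and star_star: "star (star x) = x"
    and cstar_identity: "norm (star x * x) = (norm x)\<^sup>2"

definition star_subalgebra :: "'a::cstar_algebra set \<Rightarrow> bool" where
  "star_subalgebra B \<longleftrightarrow>
     0 \<in> B \<and> (\<forall>x\<in>B. \<forall>y\<in>B. x + y \<in> B \<and> x * y \<in> B) \<and>
     (\<forall>c. \<forall>x\<in>B. scaleC c x \<in> B) \<and> (\<forall>x\<in>B. star x \<in> B)"

text \<open>Since the algebra has a unit, such a set is automatically a complex linear subspace.
  It need be neither closed nor self-adjoint.\<close>

definition two_sided_ideal :: "'a::cstar_algebra set \<Rightarrow> bool" where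
  "two_sided_ideal J \<longleftrightarrow>
     0 \<in> J \<and> (\<forall>x\<in>J. \<forall>y\<in>J. x + y \<in> J) \<and> (\<forall>a. \<forall>x\<in>J. a * x \<in> J \<and> x * a \<in> J)"

definition commutant :: "'a::cstar_algebra set \<Rightarrow> 'a set" where
  "commutant S = {a. \<forall>s\<in>S. a * s = s * a}"

definition ideal_intersection_property :: "'a::cstar_algebra set \<Rightarrow> bool" where
  "ideal_intersection_property B \<longleftrightarrow>
     (\<forall>J. two_sided_ideal J \<longrightarrow> J \<noteq> {0} \<longrightarrow> J \<inter> B \<noteq> {0})"

text \<open>Integer powers of a unitary, whose inverse is its adjoint.\<close>

definition unitary_power :: "'a::cstar_algebra \<Rightarrow> int \<Rightarrow> 'a" where
  "unitary_power u n = (if 0 \<le> n then u ^ nat n else star u ^ nat (- n))"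


section \<open>Topological dynamical systems\<close>

locale topological_dynamical_system =
  fixes X :: "'x topology" and \<sigma> :: "'x \<Rightarrow> 'x"
  assumes compact: "compact_space X"
    and Hausdorff: "Hausdorff_space X"
    and homeo: "homeomorphic_map X X \<sigma>"

text \<open>C(X). Functions are normalised to vanish off the carrier, so that equality of functions
  is equality on X and the unit is the indicator function of the carrier.\<close>

definition cont_functions :: "'x topology \<Rightarrow> ('x \<Rightarrow> complex) set" where
  "cont_functions X =
     {f. continuous_map X euclidean f \<and> (\<forall>x. x \<notin> topspace X \<longrightarrow> f x = 0)}"

definition homeo_power :: "'x topology \<Rightarrow> ('x \<Rightarrow> 'x) \<Rightarrow> int \<Rightarrow> 'x \<Rightarrow> 'x" where
  "homeo_power X \<sigma> n =
     (if 0 \<le> n then \<sigma> ^^ nat n else inv_into (topspace X) \<sigma> ^^ nat (- n))"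

text \<open>The n-th power of the automorphism \<open>\<alpha>(f) = f \<circ> \<sigma>\<^sup>-\<^sup>1\<close> of C(X).\<close>

definition alpha_power ::
    "'x topology \<Rightarrow> ('x \<Rightarrow> 'x) \<Rightarrow> int \<Rightarrow> ('x \<Rightarrow> complex) \<Rightarrow> 'x \<Rightarrow> complex" where
  "alpha_power X \<sigma> n f = (\<lambda>x. if x \<in> topspace X then f (homeo_power X \<sigma> (- n) x) else 0)"


section \<open>The algebraic crossed product and its C*-seminorms\<close>

text \<open>
  Finitely supported functions from the integers to C(X). Here \<open>a\<close> stands for the formal sum of
  the \<open>a(n) \<delta>\<^sup>n\<close>, and the product and involution are those forced by
  \<open>\<delta> f \<delta>\<^sup>* = \<alpha>(f)\<close>:
  \<open>(f \<delta>\<^sup>k) (g \<delta>\<^sup>l) = f \<alpha>\<^sup>k(g) \<delta>\<^sup>k\<^sup>+\<^sup>l\<close> and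
  \<open>(f \<delta>\<^sup>k)\<^sup>* = \<alpha>\<^sup>-\<^sup>k(cnj f) \<delta>\<^sup>-\<^sup>k\<close>.
\<close>

definition alg_crossed :: "'x topology \<Rightarrow> (int \<Rightarrow> 'x \<Rightarrow> complex) set" where
  "alg_crossed X = {a. finite {n. a n \<noteq> (\<lambda>_. 0)} \<and> (\<forall>n. a n \<in> cont_functions X)}"

definition alg_mult ::
    "'x topology \<Rightarrow> ('x \<Rightarrow> 'x) \<Rightarrow> (int \<Rightarrow> 'x \<Rightarrow> complex) \<Rightarrow> (int \<Rightarrow> 'x \<Rightarrow> complex)
       \<Rightarrow> int \<Rightarrow> 'x \<Rightarrow> complex" where
  "alg_mult X \<sigma> a b = (\<lambda>n x. \<Sum>k | a k \<noteq> (\<lambda>_. 0). a k x * alpha_power X \<sigma> k (b (n - k)) x)"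

definition alg_star ::
    "'x topology \<Rightarrow> ('x \<Rightarrow> 'x) \<Rightarrow> (int \<Rightarrow> 'x \<Rightarrow> complex) \<Rightarrow> int \<Rightarrow> 'x \<Rightarrow> complex" where
  "alg_star X \<sigma> a = (\<lambda>n x. cnj (alpha_power X \<sigma> n (a (- n)) x))"

definition cstar_seminorm ::
    "'x topology \<Rightarrow> ('x \<Rightarrow> 'x) \<Rightarrow> ((int \<Rightarrow> 'x \<Rightarrow> complex) \<Rightarrow> real) \<Rightarrow> bool" where
  "cstar_seminorm X \<sigma> p \<longleftrightarrow>
     (\<forall>a\<in>alg_crossed X. \<forall>b\<in>alg_crossed X.
        p (\<lambda>n x. a n x + b n x) \<le> p a + p b \<and> p (alg_mult X \<sigma> a b) \<le> p a * p b) \<and>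
     (\<forall>c. \<forall>a\<in>alg_crossed X. p (\<lambda>n x. c * a n x) = cmod c * p a) \<and>
     (\<forall>a\<in>alg_crossed X. p (alg_mult X \<sigma> (alg_star X \<sigma> a) a) = (p a)\<^sup>2)"


section \<open>The C*-crossed product of C(X) by the integers\<close>

text \<open>
  A C*-algebra (the whole type \<open>'a\<close>) with a copy \<open>\<iota>\<close> of C(X) and a unitary \<open>\<delta>\<close>
  is the crossed product if it is generated by a covariant pair and is universal for such pairs,
  i.e. is the completion of the algebraic crossed product in its largest C*-norm.
  Universality cannot quantify over *-homomorphisms into C*-algebras of all types. It is therefore
  expressed through the seminorms \<open>a \<mapsto> \<parallel>\<pi>(a)\<parallel>\<close> such *-homomorphisms \<open>\<pi>\<close> induce,
  which are exactly the C*-seminorms, every C*-seminorm being induced by the map into its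
  Hausdorff completion.
\<close>

locale cstar_crossed_product = topological_dynamical_system X \<sigma>
  for X :: "'x topology" and \<sigma> :: "'x \<Rightarrow> 'x" +
  fixes \<iota> :: "('x \<Rightarrow> complex) \<Rightarrow> 'a::cstar_algebra" and \<delta> :: 'a
  assumes iota_add:
      "\<lbrakk>f \<in> cont_functions X; g \<in> cont_functions X\<rbrakk> \<Longrightarrow> \<iota> (\<lambda>x. f x + g x) = \<iota> f + \<iota> g"
    and iota_scaleC: "f \<in> cont_functions X \<Longrightarrow> \<iota> (\<lambda>x. c * f x) = scaleC c (\<iota> f)"
    and iota_mult:
      "\<lbrakk>f \<in> cont_functions X; g \<in> cont_functions X\<rbrakk> \<Longrightarrow> \<iota> (\<lambda>x. f x * g x) = \<iota> f * \<iota> g"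
    and iota_star: "f \<in> cont_functions X \<Longrightarrow> \<iota> (\<lambda>x. cnj (f x)) = star (\<iota> f)"
    and iota_one: "\<iota> (indicator (topspace X)) = 1"
    and iota_inj: "inj_on \<iota> (cont_functions X)"
    and delta_unitary: "star \<delta> * \<delta> = 1" "\<delta> * star \<delta> = 1"
    and covariant: "f \<in> cont_functions X \<Longrightarrow> \<delta> * \<iota> f * star \<delta> = \<iota> (alpha_power X \<sigma> 1 f)"
    and generated:
      "\<lbrakk>closed B; star_subalgebra B; \<iota> ` cont_functions X \<subseteq> B; \<delta> \<in> B\<rbrakk> \<Longrightarrow> B = UNIV"
    and universal:
      "\<lbrakk>cstar_seminorm X \<sigma> p; a \<in> alg_crossed X\<rbrakk> \<Longrightarrow>
         p a \<le> norm (\<Sum>n | a n \<noteq> (\<lambda>_. 0). \<iota> (a n) * unitary_power \<delta> n)"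

end

theory Submission
  imports Defs
begin

text \<open>
  Write \<open>\<delta>\<close> for the unitary and \<open>E(a)\<close> for the coefficient of \<open>\<delta>\<^sup>0\<close> of a finite sum \<open>a = \<Sum> a(n) \<delta>\<^sup>n\<close>.
  Two facts about such sums carry the proof, and both come from the gauge action
  \<open>f \<delta>\<^sup>n \<mapsto> z\<^sup>n f \<delta>\<^sup>n\<close>, \<open>|z| = 1\<close>. It does not increase the norm, by universality
  (\<open>norm_rep_gauge_le\<close>), hence neither does averaging it over roots of unity with
  nonnegative weights of mean 1.
  The Fejer weights show that Fejer sums do not increase the norm (\<open>norm_rep_fejer_le\<close>). The
  first Fejer sum is \<open>E\<close>, so \<open>|E(a)(x)| \<le> \<parallel>a\<parallel>\<close> (\<open>norm_coefficient_0_le\<close>). The higher ones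
  converge to the identity, so all finite sums close to a fixed nonzero element have a coefficient
  that is bounded below by the same constant (\<open>nonzero_has_large_coefficient\<close>). In other words,
  \<open>E\<close> exists and is faithful; but it is only ever evaluated on finite sums, and never has to be
  extended to the completion.

  Now let \<open>a \<noteq> 0\<close> lie in the ideal J, let s be a finite sum near a, and put \<open>c = s\<^sup>* s\<close>. Then
  \<open>E(c)\<close> exceeds a constant \<open>\<mu>\<close> that does not depend on s on a nonempty open set W. On a smaller
  nonempty open set V every power \<open>\<sigma>\<^sup>k\<close> that matters for c either is the identity on V or moves V off
  itself (\<open>open_set_fixed_or_displaced\<close>). If g is a bump function supported in V, the compression
  \<open>d = g c g\<close> loses all terms of the second kind, and what is left commutes with C(X)
  (\<open>compression_in_commutant\<close>). So d lies in C(X)', it is close to the element \<open>j = g a\<^sup>* a g\<close> of J,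
  and \<open>E(d)(x) > \<mu>\<close> where \<open>g(x) = 1\<close>.

  It remains to replace the approximation by an exact element of J, although J need not be closed.
  Let \<open>h\<close> be twice the positive part of \<open>d - \<mu>\<close>. On the support of \<open>h\<close>, d is at least \<open>\<mu>\<close>,
  so an element j closer to d than \<open>\<mu>\<close> is still invertible there: \<open>h j = h x\<close> with x invertible,
  and \<open>h = h j x\<^sup>-\<^sup>1\<close> belongs to J (\<open>ideal_contains_positive_part\<close>). It commutes with all that d
  commutes with, and it is not zero, for \<open>h = 0\<close> would make \<open>\<mu> - d\<close> a square, hence
  \<open>E(d)(x) \<le> \<mu>\<close>. The functional calculus used here, square roots and absolute values of
  self-adjoint elements, comes from the binomial series of \<open>\<surd>(1 - z)\<close>, which converges
  absolutely on the whole closed unit ball.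
\<close>

section \<open>Elementary facts on C*-algebras\<close>

lemma scaleR_eq_scaleC: "r *\<^sub>R x = scaleC (complex_of_real r) (x :: 'a::cstar_algebra)"
  by (simp add: scaleC_of_real)

lemma scaleC_zero_left [simp]: "scaleC 0 (x :: 'a::cstar_algebra) = 0"
  using scaleC_of_real[of 0 x] by simp

lemma scaleC_one [simp]: "scaleC 1 (x :: 'a::cstar_algebra) = x"
  using scaleC_of_real[of 1 x] by simp

lemma scaleC_zero_right [simp]: "scaleC c (0 :: 'a::cstar_algebra) = 0"
  using scaleC_add_right[of c "0::'a" 0] by simp

lemma scaleC_minus_right: "scaleC c (- x) = - scaleC c (x :: 'a::cstar_algebra)"
  using scaleC_add_right[of c x "- x"] by (simp add: eq_neg_iff_add_eq_0 add.commute)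

lemma scaleC_diff_right: "scaleC c (x - y) = scaleC c x - scaleC c (y :: 'a::cstar_algebra)"
  using scaleC_add_right[of c x "- y"] by (simp add: scaleC_minus_right)

lemma scaleC_minus_left: "scaleC (- c) x = - scaleC c (x :: 'a::cstar_algebra)"
  using scaleC_add_left[of c "- c" x] by (simp add: eq_neg_iff_add_eq_0 add.commute)

lemma star_zero [simp]: "star (0 :: 'a::cstar_algebra) = 0"
  using star_add[of "0::'a" 0] by simp

lemma star_minus: "star (- x) = - star (x :: 'a::cstar_algebra)"
  using star_add[of x "- x"] by (simp add: eq_neg_iff_add_eq_0 add.commute)

lemma star_diff: "star (x - y) = star x - star (y :: 'a::cstar_algebra)"
  using star_add[of x "- y"] by (simp add: star_minus)

lemma star_one [simp]: "star (1 :: 'a::cstar_algebra) = 1"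
  by (metis mult_1_left mult_1_right star_mult star_star)

lemma star_scaleR: "star (r *\<^sub>R x) = r *\<^sub>R star (x :: 'a::cstar_algebra)"
  by (simp add: scaleR_eq_scaleC star_scaleC)

lemma star_power: "star (x ^ n) = star (x :: 'a::cstar_algebra) ^ n"
  by (induction n) (simp_all add: star_mult power_commutes)

lemma star_sum: "star (sum f A) = (\<Sum>i\<in>A. star (f i :: 'a::cstar_algebra))"
  by (induction A rule: infinite_finite_induct) (simp_all add: star_add)

lemma norm_star [simp]: "norm (star x) = norm (x :: 'a::cstar_algebra)"
proof -
  have le: "norm y \<le> norm (star y)" for y :: 'a
  proof (cases "norm y = 0")
    case False
    have "norm y * norm y \<le> norm (star y) * norm y"
      using norm_mult_ineq[of "star y" y] by (simp add: cstar_identity power2_eq_square)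
    then show ?thesis using False by (simp add: mult_le_cancel_right)
  qed simp
  show ?thesis using le[of x] le[of "star x"] by (simp add: star_star)
qed

lemma bounded_linear_star: "bounded_linear (star :: 'a::cstar_algebra \<Rightarrow> 'a)"
  by (rule bounded_linear_intro[where K = 1]) (auto simp: star_add star_scaleR)

lemma norm_unitary_le:
  assumes "star u * u = (1 :: 'a::cstar_algebra)"
  shows "norm u \<le> 1"
proof -
  have "norm (1::'a) * norm (1::'a) = norm (1::'a)"
    using cstar_identity[of "1::'a"] by (simp add: power2_eq_square)
  then have "norm (1::'a) \<le> 1" by (metis mult_cancel_right2 order.refl zero_le_one)
  moreover have "(norm u)\<^sup>2 = norm (1::'a)" using cstar_identity[of u] assms by simp
  ultimately show ?thesis by (metis power2_le_imp_le one_power2 zero_le_one)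
qed

lemma norm_one_le: "norm (1 :: 'a::cstar_algebra) \<le> 1"
  by (rule norm_unitary_le) simp

lemma norm_power_le:
  assumes "norm (x :: 'a::cstar_algebra) \<le> r"
  shows "norm (x ^ n) \<le> r ^ n"
proof (induction n)
  case 0 show ?case using norm_one_le by simp
next
  case (Suc n)
  have "norm (x * x ^ n) \<le> norm x * norm (x ^ n)" by (rule norm_mult_ineq)
  also have "\<dots> \<le> r * r ^ n"
    using assms Suc by (intro mult_mono) (auto intro: order_trans[OF norm_ge_zero])
  finally show ?case by simp
qed

lemma right_inverse_of_one_minus:
  assumes "norm (x :: 'a::cstar_algebra) < 1"
  obtains y where "(1 - x) * y = 1"
proof
  have sm: "summable (\<lambda>n. x ^ n)"
  proof (rule summable_comparison_test)
    show "summable (\<lambda>n. norm x ^ n)" using assms by (simp add: summable_geometric)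
    show "\<exists>N. \<forall>n\<ge>N. norm (x ^ n) \<le> norm x ^ n" using norm_power_le[of x "norm x"] by blast
  qed
  have "(\<Sum>n. x ^ n) = 1 + (\<Sum>n. x ^ Suc n)" using suminf_split_head[OF sm] by simp
  also have "(\<Sum>n. x ^ Suc n) = x * (\<Sum>n. x ^ n)"
    using bounded_linear.suminf[OF bounded_linear_mult_right[of x] sm] by simp
  finally show "(1 - x) * (\<Sum>n. x ^ n) = 1"
    by (simp add: left_diff_distrib algebra_simps)
qed

section \<open>Square roots and absolute values of self-adjoint elements\<close>

text \<open>
  The Taylor coefficients of \<open>\<surd>(1 - z)\<close>.
\<close>
definition sqrt_coeff :: "nat \<Rightarrow> real" where
  "sqrt_coeff n = (-1) ^ n * ((1/2) gchoose n)"

lemma sqrt_coeff_0 [simp]: "sqrt_coeff 0 = 1"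
  by (simp add: sqrt_coeff_def)

lemma sqrt_coeff_nonpos: "sqrt_coeff (Suc n) \<le> 0"
proof -
  have "sqrt_coeff (Suc n) = pochhammer (- (1/2)) (Suc n) / fact (Suc n)"
    by (simp add: sqrt_coeff_def gbinomial_pochhammer flip: power_add mult.assoc power_mult_distrib)
  also have "\<dots> = - (1/2) * pochhammer (1/2) n / fact (Suc n)"
    by (simp only: pochhammer_rec) simp
  also have "\<dots> \<le> 0"
    using pochhammer_nonneg[of "1/2::real" n] by (simp add: mult_nonneg_nonneg)
  finally show ?thesis .
qed

text \<open>
  All coefficients but the first are nonpositive, and the partial sums of the whole series are
  again binomial coefficients up to sign, hence nonnegative. This gives absolute convergence on the
  boundary of the unit disc, where it is needed: the norm bounds on z below are not strict.
\<close>
lemma sum_abs_sqrt_coeff_le: "(\<Sum>n<N. \<bar>sqrt_coeff (Suc n)\<bar>) \<le> 1"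
proof -
  have "(\<Sum>n\<le>N. sqrt_coeff n) = (-1) ^ N * (((1/2) - 1) gchoose N)"
    using gbinomial_sum_lower_neg[of "1/2::real" N]
    by (simp add: sqrt_coeff_def mult.commute)
  also have "\<dots> = pochhammer (1/2) N / fact N"
    by (simp add: gbinomial_pochhammer flip: power_add mult.assoc power_mult_distrib)
  also have "\<dots> \<ge> 0" using pochhammer_nonneg[of "1/2::real" N] by simp
  finally have "0 \<le> (\<Sum>n\<le>N. sqrt_coeff n)" .
  also have "\<dots> = 1 + (\<Sum>n<N. sqrt_coeff (Suc n))"
    by (simp add: sum.atMost_shift)
  finally show ?thesis
    using sqrt_coeff_nonpos by (simp add: abs_of_nonpos sum_negf)
qed

lemma sqrt_coeff_convolution:
  "(\<Sum>k\<le>n. sqrt_coeff k * sqrt_coeff (n - k)) = (if n = 0 then 1 else if n = 1 then -1 else 0)"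
proof -
  have "sqrt_coeff k * sqrt_coeff (n - k) = (-1) ^ n * (((1/2) gchoose k) * ((1/2) gchoose (n - k)))"
    if "k \<le> n" for k
  proof -
    have "(-1 :: real) ^ n = (-1) ^ k * (-1) ^ (n - k)" using that by (simp flip: power_add)
    then show ?thesis by (simp only: sqrt_coeff_def mult_ac)
  qed
  then have "(\<Sum>k\<le>n. sqrt_coeff k * sqrt_coeff (n - k))
      = (\<Sum>k\<le>n. (-1) ^ n * (((1/2) gchoose k) * ((1/2) gchoose (n - k))))"
    by (intro sum.cong) auto
  also have "\<dots> = (-1) ^ n * ((1/2 + 1/2 :: real) gchoose n)"
    using gbinomial_Vandermonde[of "1/2::real" "1/2" n]
    by (simp only: sum_distrib_left[symmetric] atMost_atLeast0)
  also have "\<dots> = (-1) ^ n * of_nat (1 choose n)"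
    by (metis binomial_gbinomial of_nat_1 field_sum_of_halves)
  also have "\<dots> = (if n = 0 then 1 else if n = 1 then -1 else 0)"
    by (cases n) (auto simp: binomial_eq_0)
  finally show ?thesis .
qed

text \<open>
  The series of \<open>\<surd>(1 - z)\<close> evaluated at \<open>z = 1 - r\<close>. The last two conclusions are what makes
  it usable repeatedly: the root is again in the domain of the construction, and it commutes with
  everything that r commutes with.
\<close>
lemma self_adjoint_sqrt:
  assumes sa: "star r = (r :: 'a::cstar_algebra)" and r: "norm (1 - r) \<le> 1"
  obtains q where "star q = q" "q * q = r" "norm (1 - q) \<le> 1"
    "\<And>y. r * y = y * r \<Longrightarrow> q * y = y * q"
proof
  define z where "z = 1 - r"
  define f where "f = (\<lambda>n. sqrt_coeff n *\<^sub>R z ^ n)"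
  define q where "q = suminf f"
  have zp: "norm (z ^ n) \<le> 1" for n using norm_power_le[of z 1 n] r by (simp add: z_def)
  have nf: "norm (f n) \<le> \<bar>sqrt_coeff n\<bar>" for n
    unfolding f_def norm_scaleR by (rule mult_left_le) (simp_all add: zp)
  have s1: "summable (\<lambda>n. \<bar>sqrt_coeff (Suc n)\<bar>)"
    by (rule summableI_nonneg_bounded[where x = 1]) (auto simp: sum_abs_sqrt_coeff_le)
  then have s0: "summable (\<lambda>n. \<bar>sqrt_coeff n\<bar>)"
    using summable_Suc_iff[of "\<lambda>n. \<bar>sqrt_coeff n\<bar>"] by simp
  have sn: "summable (\<lambda>n. norm (f n))"
    by (rule summable_comparison_test[OF _ s0]) (use nf in auto)
  have sf: "summable f" by (rule summable_norm_cancel[OF sn])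
  have comm: "bounded_linear L \<Longrightarrow> L (suminf f) = (\<Sum>n. L (f n))" for L :: "'a \<Rightarrow> 'a"
    by (rule bounded_linear.suminf[OF _ sf])
  have sz: "star z = z" by (simp add: z_def star_diff sa)
  show "star q = q"
    unfolding q_def comm[OF bounded_linear_star] by (simp add: f_def star_scaleR star_power sz)
  have "(\<lambda>k. \<Sum>i\<le>k. f i * f (k - i)) sums (q * q)"
    unfolding q_def by (rule Cauchy_product_sums[OF sn sn])
  moreover have "(\<Sum>i\<le>k. f i * f (k - i)) =
      (if k = 0 then 1 else if k = 1 then -1 else 0) *\<^sub>R z ^ k" for k
    unfolding sqrt_coeff_convolution[symmetric] scaleR_sum_left
    by (rule sum.cong) (auto simp: f_def simp flip: power_add)
  ultimately have "(\<lambda>k. (if k = 0 then 1 else if k = 1 then -1 else 0) *\<^sub>R z ^ k) sums (q * q)"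
    by simp
  moreover have "(\<lambda>k. (if k = 0 then 1 else if k = 1 then -1 else 0) *\<^sub>R z ^ k) sums
      (\<Sum>k\<in>{0,1}. (if k = 0 then 1 else if k = 1 then -1 else 0) *\<^sub>R z ^ k)"
    by (rule sums_finite) auto
  ultimately have "q * q = (\<Sum>k\<in>{0,1::nat}. (if k = 0 then 1 else if k = 1 then -1 else 0) *\<^sub>R z ^ k)"
    by (rule sums_unique2)
  then show "q * q = r" by (simp add: z_def)
  have "1 - q = - (\<Sum>n. f (Suc n))"
    unfolding q_def using suminf_split_head[OF sf] by (simp add: f_def)
  then have "norm (1 - q) = norm (\<Sum>n. f (Suc n))" by simp
  also have "\<dots> \<le> (\<Sum>n. \<bar>sqrt_coeff (Suc n)\<bar>)"
    by (rule norm_suminf_le) (use nf s1 in auto)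
  also have "\<dots> \<le> 1"
    by (rule suminf_le_const[OF s1]) (rule sum_abs_sqrt_coeff_le)
  finally show "norm (1 - q) \<le> 1" .
  fix y assume "r * y = y * r"
  then have "z * y = y * z" by (simp add: z_def algebra_simps)
  then have "z ^ n * y = y * z ^ n" for n
    by (induction n) (simp_all, metis mult.assoc)
  then show "q * y = y * q"
    unfolding q_def comm[OF bounded_linear_mult_left] comm[OF bounded_linear_mult_right]
    by (simp add: f_def)
qed

text \<open>
  The element \<open>x + \<i> q\<close> is unitary, and x and q are its real and imaginary parts. This is the
  substitute for spectral theory: a bound on a self-adjoint element follows from any self-adjoint
  solution q of \<open>x\<^sup>2 + q\<^sup>2 = 1\<close>.
\<close>
lemma norm_le_1_of_square_sum_1:
  assumes x: "star x = (x :: 'a::cstar_algebra)" and q: "star q = q"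
    and c: "x * q = q * x" and s: "x * x + q * q = 1"
  shows "norm x \<le> 1" "norm q \<le> 1"
proof -
  define u where "u = x + scaleC \<i> q"
  have su: "star u = x - scaleC \<i> q"
    by (simp add: u_def star_add star_scaleC x q scaleC_minus_left)
  have "star u * u = x * x + q * q"
    unfolding su by (simp add: u_def left_diff_distrib distrib_left scaleC_mult_left scaleC_mult_right
        scaleC_diff_right scaleC_scaleC scaleC_minus_left c)
  then have nu: "norm u \<le> 1" using s by (intro norm_unitary_le) simp
  then have nsu: "norm (star u) \<le> 1" by simp
  have "2 *\<^sub>R x = u + star u" unfolding su by (simp add: u_def scaleR_2)
  then have "norm (2 *\<^sub>R x) \<le> norm u + norm (star u)" using norm_triangle_ineq by metis
  then show "norm x \<le> 1" using nu nsu by simp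
  have "scaleC (2 * \<i>) q = u - star u"
    unfolding su using scaleC_add_left[of \<i> \<i> q] by (simp add: u_def)
  then have "norm (scaleC (2 * \<i>) q) \<le> norm u + norm (star u)"
    using norm_triangle_ineq4 by metis
  then show "norm q \<le> 1" using nu nsu by (simp add: norm_scaleC norm_mult)
qed

text \<open>
  The absolute value y of x is the root of \<open>x\<^sup>2\<close>. To apply the series one needs
  \<open>\<parallel>1 - x\<^sup>2\<parallel> \<le> 1\<close>. Now \<open>1 - (1 - x\<^sup>2)\<close> has norm at most 1 for trivial reasons, so
  \<open>1 - x\<^sup>2 = q\<^sup>2\<close> for a self-adjoint q, and \<open>\<parallel>q\<parallel> \<le> 1\<close> by the preceding lemma. Finally y
  is itself in the domain of the square root, which exhibits it as a square.
\<close>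
lemma self_adjoint_abs:
  assumes x: "star x = (x :: 'a::cstar_algebra)" and nx: "norm x \<le> 1"
  obtains y t where "star y = y" "y * y = x * x" "norm (1 - y) \<le> 1"
    "\<And>b. x * b = b * x \<Longrightarrow> y * b = b * y" "star t = t" "y = t * t"
proof -
  have "norm (x * x) \<le> norm x * norm x" by (rule norm_mult_ineq)
  also have "\<dots> \<le> 1" using nx by (simp add: mult_le_one)
  finally have n1: "norm (1 - (1 - x * x)) \<le> 1" by simp
  have sxx: "star (1 - x * x) = 1 - x * x" by (simp add: star_diff star_mult x)
  obtain q where q: "star q = q" "q * q = 1 - x * x"
    and qc: "\<And>b. (1 - x * x) * b = b * (1 - x * x) \<Longrightarrow> q * b = b * q"
    using self_adjoint_sqrt[OF sxx n1] by blast
  have xq: "x * q = q * x"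
    by (rule qc[symmetric]) (simp add: algebra_simps)
  have "norm q \<le> 1" by (rule norm_le_1_of_square_sum_1[OF x q(1) xq]) (simp add: q)
  then have "norm (q * q) \<le> 1"
    using norm_mult_ineq[of q q] by (meson mult_le_one norm_ge_zero order_trans)
  then have nxx: "norm (1 - x * x) \<le> 1" by (simp add: q)
  obtain y where y: "star y = y" "y * y = x * x" "norm (1 - y) \<le> 1"
    and yc: "\<And>b. x * x * b = b * (x * x) \<Longrightarrow> y * b = b * y"
    using self_adjoint_sqrt[OF _ nxx] by (metis star_mult x)
  obtain t where t: "star t = t" "t * t = y"
    using self_adjoint_sqrt[OF y(1,3)] by blast
  have "y * b = b * y" if "x * b = b * x" for b
    using yc[of b] that by (metis mult.assoc)
  then show thesis using that[OF y _ t(1) t(2)[symmetric]] by blast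
qed

section \<open>Elements of an ideal near a self-adjoint element\<close>

text \<open>
  With \<open>p = d - \<mu>\<close> and \<open>y = |p|\<close>, the element \<open>h = y + p\<close> is twice the positive part of p, so
  \<open>h p = h y\<close> and \<open>h d = h (\<mu> + y)\<close>. Hence \<open>h j = h (\<mu> + y + (j - d))\<close>, and the second factor
  is invertible because \<open>\<parallel>1 - y\<parallel> \<le> 1\<close> and \<open>\<parallel>j - d\<parallel> < \<mu>\<close>. Therefore h lies in J, without any
  closure being taken. If h vanishes then \<open>\<mu> - d\<close> is \<open>|p|\<close>, a square.
\<close>
lemma ideal_contains_positive_part:
  assumes J: "two_sided_ideal (J :: 'a::cstar_algebra set)" and j: "j \<in> J"
    and d: "star d = d" and \<mu>: "norm (d - \<mu> *\<^sub>R 1) \<le> 1"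
    and jd: "norm (j - d) < \<mu>"
  obtains h where "h \<in> J" "\<And>b. d * b = b * d \<Longrightarrow> h * b = b * h"
    "h = 0 \<Longrightarrow> \<exists>t. star t = t \<and> \<mu> *\<^sub>R 1 - d = t * t"
proof -
  define p where "p = d - \<mu> *\<^sub>R 1"
  have sp: "star p = p" by (simp add: p_def star_diff star_scaleR d)
  have np: "norm p \<le> 1" using \<mu> by (simp add: p_def)
  obtain y t where "star y = y" and y: "y * y = p * p" "norm (1 - y) \<le> 1"
    and yc: "\<And>b. p * b = b * p \<Longrightarrow> y * b = b * y" and t: "star t = t" "y = t * t"
    using self_adjoint_abs[OF sp np] by blast
  define h where "h = y + p"
  have yp: "y * p = p * y" by (rule yc) simp
  have "h * (p - y) = 0" unfolding h_def by (simp add: algebra_simps y yp)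
  then have hp: "h * p = h * y" by (simp add: right_diff_distrib)
  have \<mu>0: "\<mu> > 0" using jd norm_ge_zero[of "j - d"] by linarith
  \<comment> \<open>e is chosen so that \<open>(1 + \<mu>) (1 - e) = \<mu> + y + (j - d)\<close>; it has norm below 1.\<close>
  define e where "e = (1 / (1 + \<mu>)) *\<^sub>R ((1 - y) - (j - d))"
  have "norm ((1 - y) - (j - d)) \<le> norm (1 - y) + norm (j - d)" by (rule norm_triangle_ineq4)
  then have "norm ((1 - y) - (j - d)) < 1 + \<mu>" using y(2) jd by linarith
  then have "norm e < 1" using \<mu>0 unfolding e_def norm_scaleR by (simp add: divide_less_eq)
  then obtain v where v: "(1 - e) * v = 1" by (rule right_inverse_of_one_minus)
  have "(1 + \<mu>) *\<^sub>R (1 - e) = \<mu> *\<^sub>R 1 + y + (j - d)"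
    using \<mu>0 by (simp add: e_def scaleR_diff_right scaleR_add_left)
  moreover have "1 - e = (1 / (1 + \<mu>)) *\<^sub>R ((1 + \<mu>) *\<^sub>R (1 - e))" using \<mu>0 by simp
  ultimately have "h * (1 - e) = (1 / (1 + \<mu>)) *\<^sub>R (h * (\<mu> *\<^sub>R 1 + y + (j - d)))"
    by (metis mult_scaleR_right)
  also have "h * (\<mu> *\<^sub>R 1 + y + (j - d)) = h * j"
    using hp by (simp add: p_def algebra_simps)
  finally have he: "h * (1 - e) = (1 / (1 + \<mu>)) *\<^sub>R (h * j)" .
  have "h = h * ((1 - e) * v)" by (simp add: v)
  also have "\<dots> = ((1 / (1 + \<mu>)) *\<^sub>R (h * j)) * v" by (simp only: mult.assoc[symmetric] he)
  also have "\<dots> = ((1 / (1 + \<mu>)) *\<^sub>R h) * j * v" by simp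
  also have "\<dots> \<in> J" using J j unfolding two_sided_ideal_def by blast
  finally have "h \<in> J" .
  moreover have "h * b = b * h" if "d * b = b * d" for b
  proof -
    have "p * b = b * p" using that by (simp add: p_def algebra_simps)
    then show ?thesis using yc[of b] by (simp add: h_def algebra_simps)
  qed
  moreover have "\<exists>t. star t = t \<and> \<mu> *\<^sub>R 1 - d = t * t" if "h = 0"
  proof -
    have "y = \<mu> *\<^sub>R 1 - d" using that by (simp add: h_def p_def algebra_simps)
    then show ?thesis using t by metis
  qed
  ultimately show thesis by (rule that)
qed

section \<open>The dynamics and the functions on X\<close>

context topological_dynamical_system
begin

abbreviation hp :: "int \<Rightarrow> 'x \<Rightarrow> 'x" where "hp \<equiv> homeo_power X \<sigma>"

lemma inverse_map:
  shows "homeomorphic_map X X (inv_into (topspace X) \<sigma>)"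
    and "x \<in> topspace X \<Longrightarrow> inv_into (topspace X) \<sigma> (\<sigma> x) = x"
    and "x \<in> topspace X \<Longrightarrow> \<sigma> (inv_into (topspace X) \<sigma> x) = x"
proof -
  have inj: "inj_on \<sigma> (topspace X)" and sur: "\<sigma> ` topspace X = topspace X"
    using homeo by (auto simp: homeomorphic_eq_everything_map)
  show 1: "x \<in> topspace X \<Longrightarrow> inv_into (topspace X) \<sigma> (\<sigma> x) = x" for x
    using inj by simp
  show 2: "x \<in> topspace X \<Longrightarrow> \<sigma> (inv_into (topspace X) \<sigma> x) = x" for x
    using sur by (simp add: f_inv_into_f)
  obtain g where g: "homeomorphic_maps X X \<sigma> g"
    using homeo homeomorphic_map_maps by blast
  then have "homeomorphic_map X X g"
    using homeomorphic_maps_map by blast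
  moreover have "g x = inv_into (topspace X) \<sigma> x" if "x \<in> topspace X" for x
  proof -
    have "g (\<sigma> (inv_into (topspace X) \<sigma> x)) = inv_into (topspace X) \<sigma> x"
      using g that sur by (simp add: homeomorphic_maps_def inv_into_into)
    then show ?thesis using 2[OF that] by simp
  qed
  ultimately show "homeomorphic_map X X (inv_into (topspace X) \<sigma>)"
    by (rule homeomorphic_map_eq) auto
qed

lemma homeomorphic_map_power:
  assumes "homeomorphic_map X X f" shows "homeomorphic_map X X (f ^^ n)"
proof (induction n)
  case 0 show ?case by (simp flip: id_def)
next
  case (Suc n)
  then show ?case using homeomorphic_map_compose[OF Suc assms] by (simp add: o_def)
qed

lemma homeomorphic_map_homeo_power: "homeomorphic_map X X (hp n)"
  by (simp add: homeo_power_def homeomorphic_map_power homeo inverse_map(1))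

lemma homeo_power_in [simp]: "x \<in> topspace X \<Longrightarrow> hp n x \<in> topspace X"
  using homeomorphic_map_homeo_power[of n] homeomorphic_imp_surjective_map by blast

lemma continuous_map_homeo_power: "continuous_map X X (hp n)"
  using homeomorphic_map_homeo_power homeomorphic_imp_continuous_map by blast

lemma homeo_power_0 [simp]: "hp 0 x = x"
  by (simp add: homeo_power_def)

lemma homeo_power_succ:
  assumes x: "x \<in> topspace X" shows "hp (n + 1) x = \<sigma> (hp n x)"
proof (cases "0 \<le> n")
  case True
  then have "nat (n + 1) = Suc (nat n)" by simp
  then show ?thesis using True by (simp add: homeo_power_def)
next
  case False
  have A: "hp (n + 1) x = (inv_into (topspace X) \<sigma> ^^ nat (- (n + 1))) x"
    using False by (cases "n = -1") (auto simp: homeo_power_def)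
  have "nat (- n) = Suc (nat (- (n + 1)))" using False by simp
  then have "hp n x = inv_into (topspace X) \<sigma> (hp (n + 1) x)"
    unfolding A using False by (simp only: homeo_power_def funpow.simps o_def if_False)
  then show ?thesis using inverse_map(3)[OF homeo_power_in[OF x]] by metis
qed

lemma homeo_power_add:
  assumes x: "x \<in> topspace X" shows "hp (m + n) x = hp m (hp n x)"
proof (induction m rule: int_induct[where k = 0])
  case base show ?case by simp
next
  case (step1 m)
  have "hp (m + 1 + n) x = \<sigma> (hp (m + n) x)"
    using homeo_power_succ[OF x, of "m + n"] by (simp add: ac_simps)
  then show ?case using step1 homeo_power_succ[of "hp n x" m] x by simp
next
  case (step2 m)
  have "inv_into (topspace X) \<sigma> (\<sigma> (hp (m - 1 + n) x))
      = inv_into (topspace X) \<sigma> (\<sigma> (hp (m - 1) (hp n x)))"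
    using homeo_power_succ[OF x, of "m - 1 + n"] homeo_power_succ[of "hp n x" "m - 1"] x step2
    by simp
  then show ?case using x by (simp add: inverse_map(2))
qed

lemma homeo_power_inverse [simp]:
  assumes "x \<in> topspace X" shows "hp n (hp (- n) x) = x" "hp (- n) (hp n x) = x"
  using homeo_power_add[OF assms, of n "- n"] homeo_power_add[OF assms, of "- n" n] by auto

lemma cont_functions_continuous: "f \<in> cont_functions X \<Longrightarrow> continuous_map X euclidean f"
  by (simp add: cont_functions_def)

lemma cont_functions_outside: "f \<in> cont_functions X \<Longrightarrow> x \<notin> topspace X \<Longrightarrow> f x = 0"
  by (simp add: cont_functions_def)

lemma cont_functions_zero [simp]: "(\<lambda>_. 0) \<in> cont_functions X"
  by (simp add: cont_functions_def)

lemma cont_functions_add: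
  "f \<in> cont_functions X \<Longrightarrow> g \<in> cont_functions X \<Longrightarrow> (\<lambda>x. f x + g x) \<in> cont_functions X"
  by (auto simp: cont_functions_def intro: continuous_map_add)

lemma cont_functions_diff:
  "f \<in> cont_functions X \<Longrightarrow> g \<in> cont_functions X \<Longrightarrow> (\<lambda>x. f x - g x) \<in> cont_functions X"
  by (auto simp: cont_functions_def intro: continuous_map_diff)

lemma cont_functions_compose:
  assumes "continuous_on UNIV h" "h 0 = 0" "f \<in> cont_functions X"
  shows "(\<lambda>x. h (f x)) \<in> cont_functions X"
  using assms continuous_map_compose[of X euclidean f euclidean h]
  by (auto simp: cont_functions_def o_def continuous_map_iff_continuous2)

lemma cont_functions_mult:
  assumes "f \<in> cont_functions X" "g \<in> cont_functions X"
  shows "(\<lambda>x. f x * g x) \<in> cont_functions X"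
  using assms by (auto simp: cont_functions_def continuous_map_atin intro!: tendsto_mult)

lemma cont_functions_scale: "f \<in> cont_functions X \<Longrightarrow> (\<lambda>x. c * f x) \<in> cont_functions X"
  by (rule cont_functions_compose) (auto intro: continuous_intros)

lemma cont_functions_cnj: "f \<in> cont_functions X \<Longrightarrow> (\<lambda>x. cnj (f x)) \<in> cont_functions X"
  by (rule cont_functions_compose) (auto intro: continuous_intros)

lemma cont_functions_sum:
  "(\<And>i. i \<in> A \<Longrightarrow> f i \<in> cont_functions X) \<Longrightarrow> (\<lambda>x. \<Sum>i\<in>A. f i x) \<in> cont_functions X"
  by (induction A rule: infinite_finite_induct) (auto intro: cont_functions_add)

lemma cont_functions_restrict:
  assumes "continuous_map X euclidean f"
  shows "(\<lambda>x. if x \<in> topspace X then f x else 0) \<in> cont_functions X"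
  using continuous_map_eq[OF assms] by (auto simp: cont_functions_def)

lemma alpha_power_in: "f \<in> cont_functions X \<Longrightarrow> alpha_power X \<sigma> n f \<in> cont_functions X"
  unfolding alpha_power_def
  using continuous_map_compose[OF continuous_map_homeo_power cont_functions_continuous, of f "- n"]
  by (intro cont_functions_restrict) (simp add: o_def)

lemma cont_functions_bounded:
  assumes "f \<in> cont_functions X"
  obtains B where "0 \<le> B" "\<And>x. cmod (f x) \<le> B"
proof -
  have "compactin euclidean (f ` topspace X)"
    using compact cont_functions_continuous[OF assms]
    by (meson compact_space_def image_compactin)
  then have "bounded (f ` topspace X)" by (simp add: compact_imp_bounded)
  then obtain B where "\<forall>x\<in>topspace X. cmod (f x) \<le> B" by (auto simp: bounded_iff)
  then have "cmod (f x) \<le> max B 0" for x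
    using cont_functions_outside[OF assms] by (cases "x \<in> topspace X") (auto simp: max.coboundedI1)
  then show thesis by (intro that[of "max B 0"]) auto
qed

lemma urysohn_bump:
  assumes U: "openin X U" and x: "x \<in> U"
  obtains g :: "'x \<Rightarrow> real" where "(\<lambda>y. complex_of_real (g y)) \<in> cont_functions X" "g x = 1"
    "\<And>y. 0 \<le> g y \<and> g y \<le> 1" "\<And>y. y \<notin> U \<Longrightarrow> g y = 0"
proof -
  have xX: "x \<in> topspace X" using U x openin_subset by blast
  have "normal_space X"
    using compact Hausdorff compact_Hausdorff_or_regular_imp_normal_space by blast
  moreover have "closedin X (topspace X - U)" using U by blast
  moreover have "closedin X {x}"
    using xX Hausdorff by (simp add: closedin_Hausdorff_singleton)
  moreover have "disjnt (topspace X - U) {x}" using x by (simp add: disjnt_def)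
  ultimately obtain f where f: "continuous_map X (top_of_set {0..1::real}) f"
    "f ` (topspace X - U) \<subseteq> {0}" "f ` {x} \<subseteq> {1}"
    using Urysohn_lemma[of X "topspace X - U" "{x}" 0 1] by auto
  define g where "g y = (if y \<in> topspace X then f y else 0)" for y
  have cf: "continuous_map X euclidean f" and f01: "\<And>y. y \<in> topspace X \<Longrightarrow> f y \<in> {0..1}"
    using f(1) by (auto simp: continuous_map_in_subtopology)
  have "continuous_map X euclidean (\<lambda>y. complex_of_real (f y))"
    using continuous_map_compose[OF cf, of euclidean complex_of_real]
    by (simp add: o_def continuous_map_iff_continuous2 continuous_on_of_real)
  then have "(\<lambda>y. if y \<in> topspace X then complex_of_real (f y) else 0) \<in> cont_functions X"
    by (rule cont_functions_restrict)
  moreover have "(\<lambda>y. complex_of_real (g y)) = (\<lambda>y. if y \<in> topspace X then complex_of_real (f y) else 0)"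
    by (auto simp: g_def)
  moreover have "g x = 1" using f(3) xX by (simp add: g_def)
  moreover have "0 \<le> g y \<and> g y \<le> 1" for y using f01[of y] by (simp add: g_def)
  moreover have "g y = 0" if "y \<notin> U" for y using f(2) that by (auto simp: g_def)
  ultimately show thesis by (intro that[of g]) auto
qed

text \<open>
  Treat the finitely many powers one after the other, shrinking the open set. If a power moves some
  point y of the current set, separate y from its image; if it moves none, it is the identity
  there. Both alternatives are inherited by subsets.
\<close>
lemma open_set_fixed_or_displaced:
  assumes "finite K" "openin X W" "W \<noteq> {}"
  shows "\<exists>V. openin X V \<and> V \<noteq> {} \<and> V \<subseteq> W \<and>
    (\<forall>k\<in>K. (\<forall>y\<in>V. hp k y = y) \<or> (\<forall>y\<in>V. hp k y \<notin> V))"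
  using assms(1)
proof induction
  case empty
  then show ?case using assms by blast
next
  case (insert k K)
  then obtain V where V: "openin X V" "V \<noteq> {}" "V \<subseteq> W"
    "\<forall>k\<in>K. (\<forall>y\<in>V. hp k y = y) \<or> (\<forall>y\<in>V. hp k y \<notin> V)" by blast
  show ?case
  proof (cases "\<forall>y\<in>V. hp k y = y")
    case True
    then show ?thesis using V by blast
  next
    case False
    then obtain y where y: "y \<in> V" "hp k y \<noteq> y" by blast
    then have yX: "y \<in> topspace X" using V openin_subset by blast
    then obtain U1 U2 where U: "openin X U1" "openin X U2" "y \<in> U1" "hp k y \<in> U2" "disjnt U1 U2"
      using Hausdorff y(2) homeo_power_in unfolding Hausdorff_space_def by metis
    define V' where "V' = V \<inter> U1 \<inter> {z \<in> topspace X. hp k z \<in> U2}"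
    have "openin X V'"
      unfolding V'_def using V U openin_continuous_map_preimage[OF continuous_map_homeo_power U(2)]
      by (intro openin_Int) auto
    moreover have "y \<in> V'" using y U yX by (simp add: V'_def)
    moreover have "V' \<subseteq> V" by (auto simp: V'_def)
    moreover have "hp k z \<notin> V'" if "z \<in> V'" for z
      using that U(5) by (auto simp: V'_def disjnt_def)
    ultimately show ?thesis using V by (intro exI[of _ V']) blast
  qed
qed

end

section \<open>The algebraic crossed product\<close>

context topological_dynamical_system
begin

lemma alpha_power_add:
  "alpha_power X \<sigma> (m + n) f = alpha_power X \<sigma> m (alpha_power X \<sigma> n f)"
proof
  show "alpha_power X \<sigma> (m + n) f x = alpha_power X \<sigma> m (alpha_power X \<sigma> n f) x" for x
    using homeo_power_add[of x "- n" "- m"] by (simp add: alpha_power_def add.commute)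
qed

lemma alpha_power_0: "f \<in> cont_functions X \<Longrightarrow> alpha_power X \<sigma> 0 f = f"
  by (auto simp: alpha_power_def cont_functions_outside)

lemma alpha_power_zero [simp]: "alpha_power X \<sigma> n (\<lambda>_. 0) = (\<lambda>_. 0)"
  by (auto simp: alpha_power_def)

lemma alg_crossedD:
  "a \<in> alg_crossed X \<Longrightarrow> finite {n. a n \<noteq> (\<lambda>_. 0)}"
  "a \<in> alg_crossed X \<Longrightarrow> a n \<in> cont_functions X"
  by (auto simp: alg_crossed_def)

lemma alg_crossedI:
  assumes "finite S" "\<And>n. n \<notin> S \<Longrightarrow> a n = (\<lambda>_. 0)" "\<And>n. a n \<in> cont_functions X"
  shows "a \<in> alg_crossed X"
proof -
  have "{n. a n \<noteq> (\<lambda>_. 0)} \<subseteq> S" using assms(2) by blast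
  then show ?thesis using assms(1,3) by (auto simp: alg_crossed_def intro: finite_subset)
qed

lemma alg_add_in:
  assumes "a \<in> alg_crossed X" "b \<in> alg_crossed X"
  shows "(\<lambda>n x. a n x + b n x) \<in> alg_crossed X"
  by (rule alg_crossedI[of "{n. a n \<noteq> (\<lambda>_. 0)} \<union> {n. b n \<noteq> (\<lambda>_. 0)}"])
    (use alg_crossedD[OF assms(1)] alg_crossedD[OF assms(2)] in \<open>auto intro: cont_functions_add\<close>)

lemma alg_diff_in:
  assumes "a \<in> alg_crossed X" "b \<in> alg_crossed X"
  shows "(\<lambda>n x. a n x - b n x) \<in> alg_crossed X"
  by (rule alg_crossedI[of "{n. a n \<noteq> (\<lambda>_. 0)} \<union> {n. b n \<noteq> (\<lambda>_. 0)}"])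
    (use alg_crossedD[OF assms(1)] alg_crossedD[OF assms(2)] in \<open>auto intro: cont_functions_diff\<close>)

lemma alg_scale_in:
  assumes "a \<in> alg_crossed X"
  shows "(\<lambda>n x. c n * a n x) \<in> alg_crossed X"
  by (rule alg_crossedI[of "{n. a n \<noteq> (\<lambda>_. 0)}"])
    (use alg_crossedD[OF assms] in \<open>auto intro: cont_functions_scale\<close>)

lemma alg_mult_eq:
  assumes "finite S" "{n. a n \<noteq> (\<lambda>_. 0)} \<subseteq> S"
  shows "alg_mult X \<sigma> a b n x = (\<Sum>k\<in>S. a k x * alpha_power X \<sigma> k (b (n - k)) x)"
  unfolding alg_mult_def using assms by (intro sum.mono_neutral_left) auto

lemma alg_mult_support:
  assumes "n \<notin> (\<lambda>(k, l). k + l) ` ({k. a k \<noteq> (\<lambda>_. 0)} \<times> {l. b l \<noteq> (\<lambda>_. 0)})"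
  shows "alg_mult X \<sigma> a b n = (\<lambda>_. 0)"
proof
  fix x
  have "b (n - k) = (\<lambda>_. 0)" if "a k \<noteq> (\<lambda>_. 0)" for k
    using assms that by (force simp: image_iff)
  then show "alg_mult X \<sigma> a b n x = 0"
    unfolding alg_mult_def by (intro sum.neutral) auto
qed

lemma alg_mult_in:
  assumes "a \<in> alg_crossed X" "b \<in> alg_crossed X"
  shows "alg_mult X \<sigma> a b \<in> alg_crossed X"
proof (rule alg_crossedI[OF _ alg_mult_support])
  show "finite ((\<lambda>(k, l). k + l) ` ({k. a k \<noteq> (\<lambda>_. 0)} \<times> {l. b l \<noteq> (\<lambda>_. 0)}))"
    using assms alg_crossedD(1) by blast
  show "alg_mult X \<sigma> a b n \<in> cont_functions X" for n
    unfolding alg_mult_def using assms alg_crossedD(2)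
    by (intro cont_functions_sum cont_functions_mult alpha_power_in) auto
qed auto

lemma alg_star_in:
  assumes "a \<in> alg_crossed X"
  shows "alg_star X \<sigma> a \<in> alg_crossed X"
proof (rule alg_crossedI)
  show "finite (uminus ` {k. a k \<noteq> (\<lambda>_. 0)})" using assms alg_crossedD(1) by blast
  show "alg_star X \<sigma> a n = (\<lambda>_. 0)" if "n \<notin> uminus ` {k. a k \<noteq> (\<lambda>_. 0)}" for n
  proof -
    have "a (- n) = (\<lambda>_. 0)" using that by (force simp: image_iff)
    then show ?thesis by (simp add: alg_star_def)
  qed
  show "alg_star X \<sigma> a n \<in> cont_functions X" for n
    unfolding alg_star_def using assms alg_crossedD(2)
    by (intro cont_functions_cnj alpha_power_in) auto
qed

text \<open>
  No cancellation occurs in degree 0 of \<open>a\<^sup>* a\<close>: its value at x is a sum of squares to which every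
  coefficient of a contributes. The positivity and the faithfulness of E come from here.
\<close>
lemma alg_star_mult_self_0:
  assumes a: "a \<in> alg_crossed X" and x: "x \<in> topspace X"
  shows "alg_mult X \<sigma> (alg_star X \<sigma> a) a 0 x =
    of_real (\<Sum>k | a k \<noteq> (\<lambda>_. 0). (cmod (a k (hp k x)))\<^sup>2)"
proof -
  let ?S = "{k. a k \<noteq> (\<lambda>_. 0)}"
  have fin: "finite (uminus ` ?S)" using a alg_crossedD(1) by blast
  have "{n. alg_star X \<sigma> a n \<noteq> (\<lambda>_. 0)} \<subseteq> uminus ` ?S"
  proof
    fix n assume "n \<in> {n. alg_star X \<sigma> a n \<noteq> (\<lambda>_. 0)}"
    then have "a (- n) \<noteq> (\<lambda>_. 0)" by (auto simp: alg_star_def)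
    then show "n \<in> uminus ` ?S" by (force simp: image_iff)
  qed
  then have "alg_mult X \<sigma> (alg_star X \<sigma> a) a 0 x
      = (\<Sum>k\<in>uminus ` ?S. alg_star X \<sigma> a k x * alpha_power X \<sigma> k (a (0 - k)) x)"
    by (rule alg_mult_eq[OF fin])
  also have "\<dots> = (\<Sum>k\<in>?S. cnj (a k (hp k x)) * a k (hp k x))"
    using x by (subst sum.reindex) (auto simp: alg_star_def alpha_power_def)
  also have "\<dots> = (\<Sum>k\<in>?S. of_real ((cmod (a k (hp k x)))\<^sup>2))"
    by (rule sum.cong) (auto simp: complex_norm_square mult.commute simp del: of_real_power)
  finally show ?thesis by simp
qed

end

section \<open>The copy of C(X) and the unitary\<close>

context cstar_crossed_product
begin

abbreviation up :: "int \<Rightarrow> 'a" where "up \<equiv> unitary_power \<delta>"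

lemma unitary_power_0 [simp]: "up 0 = 1" by (simp add: unitary_power_def)
lemma unitary_power_1 [simp]: "up 1 = \<delta>" by (simp add: unitary_power_def)

lemma unitary_power_succ: "up (n + 1) = \<delta> * up n"
proof (cases "0 \<le> n")
  case True
  then have "nat (n + 1) = Suc (nat n)" by simp
  then show ?thesis using True by (simp add: unitary_power_def)
next
  case False
  have A: "up (n + 1) = star \<delta> ^ nat (- (n + 1))"
    using False by (cases "n = -1") (auto simp: unitary_power_def)
  have "nat (- n) = Suc (nat (- (n + 1)))" using False by simp
  then have "up n = star \<delta> * up (n + 1)"
    unfolding A using False by (simp only: unitary_power_def power_Suc if_False)
  then show ?thesis by (simp add: mult.assoc[symmetric] delta_unitary)
qed

lemma delta_cancel: "\<delta> * x = \<delta> * y \<Longrightarrow> x = y"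
  by (metis delta_unitary(1) mult.assoc mult_1_left)

lemma unitary_power_add: "up (m + n) = up m * up n"
proof (induction m rule: int_induct[where k = 0])
  case base show ?case by simp
next
  case (step1 m)
  have "up (m + 1 + n) = \<delta> * up (m + n)"
    using unitary_power_succ[of "m + n"] by (simp add: ac_simps)
  then show ?case using step1 by (simp add: unitary_power_succ mult.assoc)
next
  case (step2 m)
  have "\<delta> * up (m - 1 + n) = up (m + n)"
    using unitary_power_succ[of "m - 1 + n"] by simp
  also have "\<dots> = \<delta> * (up (m - 1) * up n)"
    using step2 unitary_power_succ[of "m - 1"] by (simp add: mult.assoc)
  finally show ?case by (rule delta_cancel)
qed

lemma star_unitary_power: "star (up n) = up (- n)"
  by (auto simp: unitary_power_def star_power star_star)

lemma norm_unitary_power: "norm (up n) \<le> 1"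
  by (rule norm_unitary_le) (simp add: star_unitary_power flip: unitary_power_add)

lemma unitary_power_covariant:
  assumes f: "f \<in> cont_functions X"
  shows "up n * \<iota> f = \<iota> (alpha_power X \<sigma> n f) * up n"
proof -
  have cov: "\<delta> * \<iota> g = \<iota> (alpha_power X \<sigma> 1 g) * \<delta>" if "g \<in> cont_functions X" for g
    unfolding covariant[OF that, symmetric] by (simp add: mult.assoc delta_unitary)
  have s: "\<delta> * (\<iota> (alpha_power X \<sigma> n f) * up n) = \<iota> (alpha_power X \<sigma> (n + 1) f) * up (n + 1)" for n
  proof -
    have "alpha_power X \<sigma> (n + 1) f = alpha_power X \<sigma> 1 (alpha_power X \<sigma> n f)"
      using alpha_power_add[of 1 n f] by (simp add: add.commute)
    then show ?thesis
      using cov[OF alpha_power_in[OF f, of n]] by (simp add: unitary_power_succ mult.assoc[symmetric])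
  qed
  show ?thesis
  proof (induction n rule: int_induct[where k = 0])
    case base show ?case using f by (simp add: alpha_power_0)
  next
    case (step1 m)
    then show ?case using s[of m] by (simp add: unitary_power_succ mult.assoc)
  next
    case (step2 m)
    have "\<delta> * (up (m - 1) * \<iota> f) = up m * \<iota> f"
      using unitary_power_succ[of "m - 1"] by (simp add: mult.assoc)
    also have "\<dots> = \<delta> * (\<iota> (alpha_power X \<sigma> (m - 1) f) * up (m - 1))"
      using s[of "m - 1"] step2 by simp
    finally show ?case by (rule delta_cancel)
  qed
qed

lemma iota_zero [simp]: "\<iota> (\<lambda>_. 0) = 0"
  using iota_scaleC[of "\<lambda>_. 0" 0] by simp

lemma iota_sum:
  "(\<And>i. i \<in> A \<Longrightarrow> f i \<in> cont_functions X) \<Longrightarrow> \<iota> (\<lambda>x. \<Sum>i\<in>A. f i x) = (\<Sum>i\<in>A. \<iota> (f i))"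
  by (induction A rule: infinite_finite_induct) (simp_all add: iota_add cont_functions_sum)

text \<open>
  For \<open>k = |f|\<^sup>2\<close> and \<open>r = \<surd>(1 - k\<^sup>2)\<close> the images of k and r satisfy the hypotheses of
  \<open>norm_le_1_of_square_sum_1\<close>, and \<open>\<parallel>\<iota> f\<parallel>\<^sup>2 = \<parallel>\<iota> k\<parallel>\<close>.
\<close>
lemma norm_iota_le_1:
  assumes f: "f \<in> cont_functions X" and le: "\<And>x. cmod (f x) \<le> 1"
  shows "norm (\<iota> f) \<le> 1"
proof -
  define k where "k = (\<lambda>x. cnj (f x) * f x)"
  define r where "r = (\<lambda>x. if x \<in> topspace X then complex_of_real (sqrt (1 - (cmod (f x))^4)) else 0)"
  have kC: "k \<in> cont_functions X"
    unfolding k_def by (intro cont_functions_mult cont_functions_cnj f)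
  define h where "h = (\<lambda>z. complex_of_real (sqrt (1 - (cmod z)^4)))"
  have "continuous_on UNIV h"
    unfolding h_def by (intro continuous_intros)
  then have "continuous_map X euclidean (\<lambda>x. h (f x))"
    using continuous_map_compose[OF cont_functions_continuous[OF f], of euclidean h]
    by (simp add: o_def)
  then have rC: "r \<in> cont_functions X"
    unfolding r_def h_def by (rule cont_functions_restrict)
  have "\<iota> k * \<iota> k + \<iota> r * \<iota> r = \<iota> (\<lambda>x. k x * k x + r x * r x)"
    using kC rC by (simp add: iota_mult iota_add cont_functions_mult)
  also have "(\<lambda>x. k x * k x + r x * r x) = indicator (topspace X)"
  proof
    fix x
    have 1: "(cmod (f x))^4 \<le> 1" using le[of x] by (simp add: power_le_one)
    have "k x = complex_of_real ((cmod (f x))\<^sup>2)"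
      unfolding k_def complex_norm_square by (simp add: mult.commute)
    then have "k x * k x = complex_of_real ((cmod (f x))^4)"
      by (simp flip: of_real_mult power_add)
    moreover have "r x * r x = complex_of_real (1 - (cmod (f x))^4)" if "x \<in> topspace X"
      using that 1 by (simp add: r_def flip: of_real_mult)
    ultimately show "k x * k x + r x * r x = indicator (topspace X) x"
      using cont_functions_outside[OF f] by (cases "x \<in> topspace X") (auto simp: r_def)
  qed
  finally have sq: "\<iota> k * \<iota> k + \<iota> r * \<iota> r = 1" by (simp add: iota_one)
  have "star (\<iota> k) = \<iota> k" using iota_star[OF kC] by (simp add: k_def mult.commute)
  moreover have "star (\<iota> r) = \<iota> r"
  proof -
    have "(\<lambda>x. cnj (r x)) = r" by (auto simp: r_def)
    then show ?thesis using iota_star[OF rC] by simp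
  qed
  moreover have "\<iota> k * \<iota> r = \<iota> r * \<iota> k"
    using kC rC iota_mult[of k r] iota_mult[of r k] by (simp add: mult.commute)
  ultimately have "norm (\<iota> k) \<le> 1" using sq by (rule norm_le_1_of_square_sum_1)
  moreover have "\<iota> k = star (\<iota> f) * \<iota> f"
    unfolding k_def using f by (simp add: iota_mult iota_star cont_functions_cnj)
  ultimately have "(norm (\<iota> f))\<^sup>2 \<le> 1" by (simp add: cstar_identity)
  then show ?thesis using power2_le_imp_le[of "norm (\<iota> f)" 1] by simp
qed

lemma norm_iota_le:
  assumes f: "f \<in> cont_functions X" and le: "\<And>x. cmod (f x) \<le> B"
  shows "norm (\<iota> f) \<le> B"
proof (cases "B = 0")
  case True
  then have "f = (\<lambda>_. 0)" using le by auto
  then show ?thesis using True by simp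
next
  case False
  have "0 \<le> B" using le norm_ge_zero order_trans by blast
  then have B: "0 < B" using False by simp
  define g where "g = (\<lambda>x. of_real (1 / B) * f x)"
  have g: "g \<in> cont_functions X" unfolding g_def by (rule cont_functions_scale[OF f])
  have "norm (\<iota> g) \<le> 1"
    by (rule norm_iota_le_1[OF g]) (use le B in \<open>simp add: g_def norm_mult norm_divide divide_le_eq\<close>)
  moreover have "\<iota> g = scaleC (of_real (1 / B)) (\<iota> f)"
    unfolding g_def by (rule iota_scaleC[OF f])
  ultimately show ?thesis using B by (simp add: norm_scaleC norm_divide divide_le_eq)
qed

text \<open>
  If \<open>\<parallel>\<iota> f\<parallel> < \<mu> < |f x|\<close>, take a bump function g at x supported where \<open>|f| > \<mu>\<close>. There f
  has an inverse u of sup norm at most \<open>1 / \<mu>\<close>, so \<open>g = g u f\<close> and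
  \<open>\<parallel>\<iota> g\<parallel> \<le> \<parallel>\<iota> g\<parallel> \<parallel>\<iota> f\<parallel> / \<mu>\<close>. Hence \<open>\<iota> g = 0\<close>, which contradicts injectivity.
\<close>
lemma norm_iota_ge:
  assumes f: "f \<in> cont_functions X"
  shows "cmod (f x) \<le> norm (\<iota> f)"
proof (rule ccontr)
  assume "\<not> ?thesis"
  then obtain \<mu> where \<mu>: "norm (\<iota> f) < \<mu>" "\<mu> < cmod (f x)" using dense by (auto simp: not_le)
  have \<mu>0: "0 < \<mu>" using \<mu>(1) norm_ge_zero[of "\<iota> f"] by linarith
  have xX: "x \<in> topspace X" using cont_functions_outside[OF f] \<mu>(2) \<mu>0 by fastforce
  define U where "U = {y \<in> topspace X. f y \<in> {z. \<mu> < cmod z}}"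
  have "open {z::complex. \<mu> < cmod z}" by (intro open_Collect_less continuous_intros)
  then have "openin X U"
    unfolding U_def by (intro openin_continuous_map_preimage[OF cont_functions_continuous[OF f]]) simp
  moreover have "x \<in> U" using \<mu> xX by (simp add: U_def)
  ultimately obtain g where gC: "(\<lambda>y. complex_of_real (g y)) \<in> cont_functions X" and g1: "g x = 1"
    and g0: "\<And>y. y \<notin> U \<Longrightarrow> g y = 0"
    using urysohn_bump by metis
  let ?g = "\<lambda>y. complex_of_real (g y)"
  \<comment> \<open>h is \<open>1 / z\<close> for \<open>|z| \<ge> \<mu>\<close>, continued to the disc so that it vanishes at 0.\<close>
  define h where "h = (\<lambda>z. cnj z / complex_of_real (max ((cmod z)\<^sup>2) (\<mu>\<^sup>2)))"
  define u where "u = (\<lambda>y. h (f y))"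
  have nz: "max ((cmod z)\<^sup>2) (\<mu>\<^sup>2) > 0" for z using \<mu>0 by (simp add: less_max_iff_disj)
  have "complex_of_real (max ((cmod z)\<^sup>2) (\<mu>\<^sup>2)) \<noteq> 0" for z
    using nz[of z] by (metis less_irrefl of_real_eq_0_iff)
  then have "continuous_on UNIV h"
    unfolding h_def by (intro continuous_intros) blast
  moreover have "h 0 = 0" by (simp add: h_def)
  ultimately have uC: "u \<in> cont_functions X"
    unfolding u_def using f by (rule cont_functions_compose)
  have "cmod (h z) \<le> 1 / \<mu>" for z
  proof -
    have "cmod z * \<mu> \<le> max ((cmod z)\<^sup>2) (\<mu>\<^sup>2)"
    proof (cases "cmod z \<le> \<mu>")
      case True
      then show ?thesis using \<mu>0 by (simp add: power2_eq_square max.coboundedI2 mult_right_mono)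
    next
      case False
      then show ?thesis by (simp add: power2_eq_square max.coboundedI1 mult_left_mono)
    qed
    moreover have "cmod (h z) = cmod z / max ((cmod z)\<^sup>2) (\<mu>\<^sup>2)"
      using nz[of z] by (simp add: h_def norm_divide)
    ultimately show ?thesis using nz[of z] \<mu>0 by (simp only: pos_divide_le_eq) (simp add: pos_le_divide_eq)
  qed
  then have nu: "norm (\<iota> u) \<le> 1 / \<mu>" by (intro norm_iota_le[OF uC]) (simp add: u_def)
  have gu: "?g y = ?g y * (u y * f y)" for y
  proof (cases "y \<in> U")
    case True
    then have "\<mu> < cmod (f y)" by (simp add: U_def)
    then have "(\<mu>)\<^sup>2 \<le> (cmod (f y))\<^sup>2" using \<mu>0 by (intro power_mono) auto
    moreover have "u y * f y = (f y * cnj (f y)) / complex_of_real (max ((cmod (f y))\<^sup>2) (\<mu>\<^sup>2))"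
      by (simp only: u_def h_def times_divide_eq_left times_divide_eq_right mult.commute)
    ultimately have "u y * f y = complex_of_real ((cmod (f y))\<^sup>2) / complex_of_real ((cmod (f y))\<^sup>2)"
      by (simp only: max_absorb1 complex_norm_square)
    moreover have "f y \<noteq> 0" using \<open>\<mu> < cmod (f y)\<close> \<mu>0 by auto
    ultimately have "u y * f y = 1" by simp
    then show ?thesis by simp
  qed (simp add: g0)
  have "\<iota> ?g = \<iota> (\<lambda>y. ?g y * (u y * f y))"
    by (rule arg_cong[where f = \<iota>], rule ext) (rule gu)
  also have "\<dots> = \<iota> ?g * (\<iota> u * \<iota> f)"
    by (simp add: iota_mult gC uC f cont_functions_mult)
  finally have "norm (\<iota> ?g) \<le> norm (\<iota> ?g) * norm (\<iota> u * \<iota> f)"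
    using norm_mult_ineq by metis
  moreover have "norm (\<iota> u * \<iota> f) < 1"
  proof -
    have "norm (\<iota> u * \<iota> f) \<le> norm (\<iota> u) * norm (\<iota> f)" by (rule norm_mult_ineq)
    also have "\<dots> \<le> 1 / \<mu> * norm (\<iota> f)" using nu by (intro mult_right_mono) auto
    also have "\<dots> < 1" using \<mu>(1) \<mu>0 by (simp add: divide_less_eq)
    finally show ?thesis .
  qed
  ultimately have "norm (\<iota> ?g) = 0"
    using mult_strict_left_mono[of "norm (\<iota> u * \<iota> f)" 1 "norm (\<iota> ?g)"] by fastforce
  then have "\<iota> ?g = \<iota> (\<lambda>_. 0)" by simp
  then have "?g = (\<lambda>_. 0)" by (rule inj_onD[OF iota_inj _ gC cont_functions_zero])
  then have "?g x = 0" by (rule fun_cong)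
  then show False using g1 by simp
qed

section \<open>The canonical map of the algebraic crossed product\<close>

definition rep :: "(int \<Rightarrow> 'x \<Rightarrow> complex) \<Rightarrow> 'a" where
  "rep a = (\<Sum>n | a n \<noteq> (\<lambda>_. 0). \<iota> (a n) * up n)"

lemma rep_eq:
  assumes "finite S" "{n. a n \<noteq> (\<lambda>_. 0)} \<subseteq> S"
  shows "rep a = (\<Sum>n\<in>S. \<iota> (a n) * up n)"
  unfolding rep_def using assms by (intro sum.mono_neutral_left) auto

lemma rep_add:
  assumes a: "a \<in> alg_crossed X" and b: "b \<in> alg_crossed X"
  shows "rep (\<lambda>n x. a n x + b n x) = rep a + rep b"
proof -
  let ?S = "{n. a n \<noteq> (\<lambda>_. 0)} \<union> {n. b n \<noteq> (\<lambda>_. 0)}"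
  have S: "finite ?S" using a b alg_crossedD(1) by blast
  have "rep (\<lambda>n x. a n x + b n x) = (\<Sum>n\<in>?S. \<iota> (\<lambda>x. a n x + b n x) * up n)"
    by (rule rep_eq[OF S]) auto
  also have "\<dots> = (\<Sum>n\<in>?S. \<iota> (a n) * up n) + (\<Sum>n\<in>?S. \<iota> (b n) * up n)"
    using a b alg_crossedD(2) by (simp add: iota_add distrib_right sum.distrib)
  also have "\<dots> = rep a + rep b"
    using rep_eq[OF S, of a] rep_eq[OF S, of b] by auto
  finally show ?thesis .
qed

lemma scaleC_sum: "scaleC c (sum f A) = (\<Sum>i\<in>A. scaleC c (f i :: 'a))"
  by (induction A rule: infinite_finite_induct) (simp_all add: scaleC_add_right)

lemma rep_scale:
  assumes a: "a \<in> alg_crossed X"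
  shows "rep (\<lambda>n x. c * a n x) = scaleC c (rep a)"
proof -
  let ?S = "{n. a n \<noteq> (\<lambda>_. 0)}"
  have S: "finite ?S" using a alg_crossedD(1) by blast
  have "rep (\<lambda>n x. c * a n x) = (\<Sum>n\<in>?S. \<iota> (\<lambda>x. c * a n x) * up n)"
    by (rule rep_eq[OF S]) auto
  also have "\<dots> = scaleC c (\<Sum>n\<in>?S. \<iota> (a n) * up n)"
    using a alg_crossedD(2) by (simp add: iota_scaleC scaleC_mult_left scaleC_sum)
  finally show ?thesis by (simp add: rep_def)
qed

lemma rep_diff:
  assumes a: "a \<in> alg_crossed X" and b: "b \<in> alg_crossed X"
  shows "rep (\<lambda>n x. a n x - b n x) = rep a - rep b"
  using rep_add[OF a alg_scale_in[OF b, of "\<lambda>_. -1"]] rep_scale[OF b, of "-1"]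
  by (simp add: scaleC_minus_left)

lemma rep_sum:
  assumes "\<And>i. i \<in> A \<Longrightarrow> f i \<in> alg_crossed X"
  shows "rep (\<lambda>n x. \<Sum>i\<in>A. f i n x) = (\<Sum>i\<in>A. rep (f i)) \<and> (\<lambda>n x. \<Sum>i\<in>A. f i n x) \<in> alg_crossed X"
  using assms
proof (induction A rule: infinite_finite_induct)
  case (insert i A)
  then show ?case
    using rep_add[of "f i" "\<lambda>n x. \<Sum>i\<in>A. f i n x"] alg_add_in[of "f i" "\<lambda>n x. \<Sum>i\<in>A. f i n x"] by auto
qed (auto simp: rep_def intro: alg_crossedI[of "{}"])

lemma rep_mult:
  assumes a: "a \<in> alg_crossed X" and b: "b \<in> alg_crossed X"
  shows "rep (alg_mult X \<sigma> a b) = rep a * rep b"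
proof -
  let ?A = "{n. a n \<noteq> (\<lambda>_. 0)}" and ?B = "{n. b n \<noteq> (\<lambda>_. 0)}"
  define T where "T k l = \<iota> (\<lambda>x. a k x * alpha_power X \<sigma> k (b l) x) * up (k + l)" for k l
  have A: "finite ?A" and B: "finite ?B" using a b alg_crossedD(1) by blast+
  have aC: "a k \<in> cont_functions X" and bC: "b k \<in> cont_functions X" for k
    using a b alg_crossedD(2) by blast+
  have T: "T k l = (\<iota> (a k) * up k) * (\<iota> (b l) * up l)" for k l
  proof -
    have "T k l = \<iota> (a k) * (\<iota> (alpha_power X \<sigma> k (b l)) * up k) * up l"
      by (simp add: T_def iota_mult aC bC alpha_power_in unitary_power_add mult.assoc)
    then show ?thesis
      by (simp add: unitary_power_covariant[OF bC, symmetric] mult.assoc)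
  qed
  let ?S = "(\<lambda>(k, l). k + l) ` (?A \<times> ?B)"
  have S: "finite ?S" using A B by blast
  have "rep (alg_mult X \<sigma> a b) = (\<Sum>n\<in>?S. \<iota> (alg_mult X \<sigma> a b n) * up n)"
    by (rule rep_eq[OF S]) (use alg_mult_support[of _ a b] in blast)
  also have "\<dots> = (\<Sum>n\<in>?S. \<Sum>k\<in>?A. T k (n - k))"
    unfolding alg_mult_def
    by (subst iota_sum) (simp_all add: aC bC cont_functions_mult alpha_power_in T_def sum_distrib_right)
  also have "\<dots> = (\<Sum>k\<in>?A. \<Sum>n\<in>?S. T k (n - k))" by (rule sum.swap)
  also have "\<dots> = (\<Sum>k\<in>?A. \<Sum>l\<in>?B. T k l)"
  proof (rule sum.cong[OF refl])
    fix k assume k: "k \<in> ?A"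
    have sub: "(\<lambda>l. k + l) ` ?B \<subseteq> ?S"
    proof
      fix n assume "n \<in> (\<lambda>l. k + l) ` ?B"
      then obtain l where "l \<in> ?B" "n = k + l" by blast
      then show "n \<in> ?S" using k by (intro image_eqI[of _ _ "(k, l)"]) auto
    qed
    have "(\<Sum>n\<in>?S. T k (n - k)) = (\<Sum>n\<in>(\<lambda>l. k + l) ` ?B. T k (n - k))"
    proof (rule sum.mono_neutral_right[OF S sub], intro ballI)
      fix n assume n: "n \<in> ?S - (\<lambda>l. k + l) ` ?B"
      have "b (n - k) = (\<lambda>_. 0)"
      proof (rule ccontr)
        assume "\<not> ?thesis"
        then have "n \<in> (\<lambda>l. k + l) ` ?B" by (intro image_eqI[of _ _ "n - k"]) auto
        then show False using n by blast
      qed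
      then show "T k (n - k) = 0" by (simp add: T_def)
    qed
    also have "\<dots> = (\<Sum>l\<in>?B. T k l)" by (subst sum.reindex) (auto simp: inj_on_def)
    finally show "(\<Sum>n\<in>?S. T k (n - k)) = (\<Sum>l\<in>?B. T k l)" .
  qed
  also have "\<dots> = rep a * rep b" by (simp only: rep_def sum_product T)
  finally show ?thesis .
qed

lemma rep_star:
  assumes a: "a \<in> alg_crossed X"
  shows "rep (alg_star X \<sigma> a) = star (rep a)"
proof -
  let ?A = "{n. a n \<noteq> (\<lambda>_. 0)}"
  have A: "finite (uminus ` ?A)" using a alg_crossedD(1) by blast
  have aC: "a k \<in> cont_functions X" for k using a alg_crossedD(2) by blast
  have cC: "(\<lambda>x. cnj (a k x)) \<in> cont_functions X" for k by (rule cont_functions_cnj[OF aC])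
  have "rep (alg_star X \<sigma> a) = (\<Sum>n\<in>uminus ` ?A. \<iota> (alg_star X \<sigma> a n) * up n)"
  proof (rule rep_eq[OF A])
    show "{n. alg_star X \<sigma> a n \<noteq> (\<lambda>_. 0)} \<subseteq> uminus ` ?A"
    proof
      fix n assume "n \<in> {n. alg_star X \<sigma> a n \<noteq> (\<lambda>_. 0)}"
      then have "a (- n) \<noteq> (\<lambda>_. 0)" by (auto simp: alg_star_def)
      then show "n \<in> uminus ` ?A" by (force simp: image_iff)
    qed
  qed
  also have "\<dots> = (\<Sum>n\<in>?A. \<iota> (alg_star X \<sigma> a (- n)) * up (- n))"
    by (subst sum.reindex) auto
  also have "\<dots> = (\<Sum>n\<in>?A. star (\<iota> (a n) * up n))"
  proof (rule sum.cong[OF refl])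
    fix n
    have "alg_star X \<sigma> a (- n) = alpha_power X \<sigma> (- n) (\<lambda>x. cnj (a n x))"
      by (auto simp: alg_star_def alpha_power_def)
    then show "\<iota> (alg_star X \<sigma> a (- n)) * up (- n) = star (\<iota> (a n) * up n)"
      by (simp add: star_mult star_unitary_power unitary_power_covariant[OF cC, symmetric] iota_star aC)
  qed
  finally show ?thesis by (simp add: rep_def star_sum)
qed

lemma norm_rep_le:
  assumes a: "a \<in> alg_crossed X" and B: "\<And>n x. cmod (a n x) \<le> B n"
    and S: "finite S" "{n. a n \<noteq> (\<lambda>_. 0)} \<subseteq> S"
  shows "norm (rep a) \<le> (\<Sum>n\<in>S. B n)"
proof -
  have "norm (rep a) \<le> (\<Sum>n\<in>S. norm (\<iota> (a n) * up n))"
    unfolding rep_eq[OF S] by (rule norm_sum)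
  also have "\<dots> \<le> (\<Sum>n\<in>S. B n)"
  proof (rule sum_mono)
    fix n
    have "norm (\<iota> (a n) * up n) \<le> norm (\<iota> (a n)) * norm (up n)" by (rule norm_mult_ineq)
    also have "\<dots> \<le> norm (\<iota> (a n))"
      using norm_unitary_power[of n] by (intro mult_left_le) auto
    also have "\<dots> \<le> B n" by (rule norm_iota_le[OF alg_crossedD(2)[OF a] B])
    finally show "norm (\<iota> (a n) * up n) \<le> B n" .
  qed
  finally show ?thesis .
qed

definition monomial :: "('x \<Rightarrow> complex) \<Rightarrow> int \<Rightarrow> int \<Rightarrow> 'x \<Rightarrow> complex" where
  "monomial f k = (\<lambda>n. if n = k then f else (\<lambda>_. 0))"

lemma monomial_in: "f \<in> cont_functions X \<Longrightarrow> monomial f k \<in> alg_crossed X"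
  by (rule alg_crossedI[of "{k}"]) (auto simp: monomial_def)

lemma rep_monomial: "rep (monomial f k) = \<iota> f * up k"
proof -
  have "{n. monomial f k n \<noteq> (\<lambda>_. 0)} \<subseteq> {k}" by (auto simp: monomial_def)
  then have "rep (monomial f k) = (\<Sum>n\<in>{k}. \<iota> (monomial f k n) * up n)" by (intro rep_eq) auto
  then show ?thesis by (simp add: monomial_def)
qed

lemma cont_functions_indicator: "indicator (topspace X) \<in> cont_functions X"
proof -
  have "(\<lambda>x. if x \<in> topspace X then 1 else 0 :: complex) \<in> cont_functions X"
    by (rule cont_functions_restrict) simp
  moreover have "(\<lambda>x. if x \<in> topspace X then 1 else 0 :: complex) = indicator (topspace X)"
    by auto
  ultimately show ?thesis by simp
qed

text \<open>
  The closure of the image is a closed star subalgebra that contains the generators.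
\<close>
lemma rep_dense:
  assumes "0 < e"
  obtains a where "a \<in> alg_crossed X" "norm (rep a - y) < e"
proof -
  let ?R = "rep ` alg_crossed X"
  have lim: "(l \<in> closure ?R) \<longleftrightarrow> (\<exists>x. (\<forall>n. x n \<in> ?R) \<and> x \<longlonglongrightarrow> l)" for l
    by (rule closure_sequential)
  have limI: "l \<in> closure ?R" if "\<And>n. w n \<in> ?R" "w \<longlonglongrightarrow> l" for w l
    unfolding lim using that by blast
  have R_add: "p + q \<in> ?R" and R_mult: "p * q \<in> ?R" if pq: "p \<in> ?R" "q \<in> ?R" for p q
  proof -
    obtain a b where ab: "a \<in> alg_crossed X" "p = rep a" "b \<in> alg_crossed X" "q = rep b"
      using pq by blast
    show "p + q \<in> ?R"
      unfolding ab(2,4) rep_add[OF ab(1,3), symmetric] by (intro imageI alg_add_in ab)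
    show "p * q \<in> ?R"
      unfolding ab(2,4) rep_mult[OF ab(1,3), symmetric] by (intro imageI alg_mult_in ab)
  qed
  have R_scale: "scaleC c p \<in> ?R" and R_star: "star p \<in> ?R" if p: "p \<in> ?R" for c p
  proof -
    obtain a where a: "a \<in> alg_crossed X" "p = rep a" using p by blast
    show "scaleC c p \<in> ?R"
      unfolding a(2) rep_scale[OF a(1), symmetric] by (intro imageI alg_scale_in a)
    show "star p \<in> ?R"
      unfolding a(2) rep_star[OF a(1), symmetric] by (intro imageI alg_star_in a)
  qed
  have RC: "p \<in> closure ?R" if "p \<in> ?R" for p using closure_subset that by (rule subsetD)
  have mono_R: "\<iota> f * up k \<in> closure ?R" if "f \<in> cont_functions X" for f k
    unfolding rep_monomial[symmetric] by (intro RC imageI monomial_in that)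
  have "0 \<in> closure ?R" using mono_R[OF cont_functions_zero, of 0] by simp
  moreover have "x + z \<in> closure ?R \<and> x * z \<in> closure ?R"
    if x: "x \<in> closure ?R" and z: "z \<in> closure ?R" for x z
  proof -
    obtain u v where u: "\<And>n. u n \<in> ?R" "u \<longlonglongrightarrow> x" and v: "\<And>n. v n \<in> ?R" "v \<longlonglongrightarrow> z"
      using x z unfolding lim by blast
    show ?thesis
      using limI[OF R_add[OF u(1) v(1)] tendsto_add[OF u(2) v(2)]]
        limI[OF R_mult[OF u(1) v(1)] tendsto_mult[OF u(2) v(2)]] by (rule conjI)
  qed
  moreover have "scaleC c x \<in> closure ?R" if x: "x \<in> closure ?R" for c x
  proof -
    obtain u where u: "\<And>n. u n \<in> ?R" "u \<longlonglongrightarrow> x"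
      using x unfolding lim by blast
    have bl: "bounded_linear (scaleC c :: 'a \<Rightarrow> 'a)"
      by (rule bounded_linear_intro[where K = "cmod c"])
        (auto simp: scaleC_add_right norm_scaleC scaleR_eq_scaleC scaleC_scaleC mult.commute)
    show ?thesis by (rule limI[OF R_scale[OF u(1)] bounded_linear.tendsto[OF bl u(2)]])
  qed
  moreover have "star x \<in> closure ?R" if x: "x \<in> closure ?R" for x
  proof -
    obtain u where u: "\<And>n. u n \<in> ?R" "u \<longlonglongrightarrow> x"
      using x unfolding lim by blast
    show ?thesis by (rule limI[OF R_star[OF u(1)] bounded_linear.tendsto[OF bounded_linear_star u(2)]])
  qed
  ultimately have "star_subalgebra (closure ?R)" by (simp add: star_subalgebra_def)
  moreover have "\<iota> ` cont_functions X \<subseteq> closure ?R"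
  proof
    fix w assume "w \<in> \<iota> ` cont_functions X"
    then show "w \<in> closure ?R" using mono_R[of _ 0] by auto
  qed
  moreover have "\<delta> \<in> closure ?R" using mono_R[OF cont_functions_indicator, of 1] by (simp add: iota_one)
  ultimately have "closure ?R = UNIV" by (intro generated) auto
  then have "y \<in> closure ?R" by simp
  then have "\<exists>w\<in>?R. dist w y < e" using assms by (simp only: closure_approachable)
  then obtain a where "a \<in> alg_crossed X" "dist (rep a) y < e" by blast
  then show thesis by (intro that[of a]) (simp_all only: dist_norm)
qed

section \<open>The gauge action\<close>

definition gauge :: "complex \<Rightarrow> (int \<Rightarrow> 'x \<Rightarrow> complex) \<Rightarrow> int \<Rightarrow> 'x \<Rightarrow> complex" where
  "gauge z a = (\<lambda>n x. z powi n * a n x)"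

lemma gauge_in: "a \<in> alg_crossed X \<Longrightarrow> gauge z a \<in> alg_crossed X"
  unfolding gauge_def by (rule alg_scale_in)

lemma gauge_mult:
  assumes z: "z \<noteq> 0"
  shows "gauge z (alg_mult X \<sigma> a b) = alg_mult X \<sigma> (gauge z a) (gauge z b)"
proof (intro ext)
  fix n x
  have supp: "{k. gauge z a k \<noteq> (\<lambda>_. 0)} = {k. a k \<noteq> (\<lambda>_. 0)}"
    using z by (auto simp: gauge_def fun_eq_iff)
  have "z powi n = z powi k * z powi (n - k)" for k
    using z by (simp flip: power_int_add)
  then have "z powi n * (a k x * alpha_power X \<sigma> k (b (n - k)) x) =
      gauge z a k x * alpha_power X \<sigma> k (gauge z b (n - k)) x" for k
    by (simp add: gauge_def alpha_power_def)
  note term_eq = this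
  have "gauge z (alg_mult X \<sigma> a b) n x =
      (\<Sum>k | a k \<noteq> (\<lambda>_. 0). z powi n * (a k x * alpha_power X \<sigma> k (b (n - k)) x))"
    by (simp add: gauge_def alg_mult_def sum_distrib_left)
  also have "\<dots> = alg_mult X \<sigma> (gauge z a) (gauge z b) n x"
    unfolding alg_mult_def supp by (simp only: term_eq)
  finally show "gauge z (alg_mult X \<sigma> a b) n x = alg_mult X \<sigma> (gauge z a) (gauge z b) n x" .
qed

lemma gauge_star:
  assumes z: "cmod z = 1"
  shows "gauge z (alg_star X \<sigma> a) = alg_star X \<sigma> (gauge z a)"
proof (intro ext)
  fix n x
  have "inverse z = cnj z"
    using z by (metis complex_norm_square divide_conv_cnj inverse_eq_divide mult_1 complex_cnj_cnj div_by_1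
        power_one of_real_1)
  then have "z powi n = cnj (z powi (- n))"
    by (simp add: power_int_minus flip: power_int_inverse)
  then show "gauge z (alg_star X \<sigma> a) n x = alg_star X \<sigma> (gauge z a) n x"
    by (simp add: gauge_def alg_star_def alpha_power_def)
qed

text \<open>
  The gauge action consists of star automorphisms of the algebraic crossed product, so composing the
  norm with it gives a C*-seminorm. Universality bounds that seminorm by the norm.
\<close>
lemma norm_rep_gauge_le:
  assumes z: "cmod z = 1" and a: "a \<in> alg_crossed X"
  shows "norm (rep (gauge z a)) \<le> norm (rep a)"
proof -
  have z0: "z \<noteq> 0" using z by auto
  have "cstar_seminorm X \<sigma> (\<lambda>a. norm (rep (gauge z a)))"
    unfolding cstar_seminorm_def
  proof (intro conjI ballI allI)
    fix a b assume a: "a \<in> alg_crossed X" and b: "b \<in> alg_crossed X"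
    note g = gauge_in[OF a, of z] gauge_in[OF b, of z]
    have "gauge z (\<lambda>n x. a n x + b n x) = (\<lambda>n x. gauge z a n x + gauge z b n x)"
      by (simp add: gauge_def distrib_left)
    then show "norm (rep (gauge z (\<lambda>n x. a n x + b n x))) \<le> norm (rep (gauge z a)) + norm (rep (gauge z b))"
      by (simp add: rep_add g norm_triangle_ineq)
    show "norm (rep (gauge z (alg_mult X \<sigma> a b))) \<le> norm (rep (gauge z a)) * norm (rep (gauge z b))"
      by (simp add: gauge_mult[OF z0] rep_mult g norm_mult_ineq)
  next
    fix c a assume a: "a \<in> alg_crossed X"
    have "gauge z (\<lambda>n x. c * a n x) = (\<lambda>n x. c * gauge z a n x)"
      by (simp add: gauge_def mult.left_commute)
    then show "norm (rep (gauge z (\<lambda>n x. c * a n x))) = cmod c * norm (rep (gauge z a))"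
      by (simp add: rep_scale gauge_in a norm_scaleC)
  next
    fix a assume a: "a \<in> alg_crossed X"
    show "norm (rep (gauge z (alg_mult X \<sigma> (alg_star X \<sigma> a) a))) = (norm (rep (gauge z a)))\<^sup>2"
      by (simp add: gauge_mult[OF z0] gauge_star[OF z] rep_mult rep_star gauge_in alg_star_in a cstar_identity)
  qed
  from universal[OF this a] show ?thesis by (simp add: rep_def)
qed

end

section \<open>Fejer sums\<close>

text \<open>
  Truncated subtraction makes the weight \<open>1 - |n| / N\<close> vanish for \<open>|n| \<ge> N\<close>.
\<close>
definition fejer_weight :: "nat \<Rightarrow> int \<Rightarrow> real" where
  "fejer_weight N n = real (N - nat \<bar>n\<bar>) / real N"

lemma fejer_weight_bounds: "0 \<le> fejer_weight N n" "fejer_weight N n \<le> 1"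
  by (auto simp: fejer_weight_def divide_le_eq_1)

lemma fejer_weight_0: "0 < N \<Longrightarrow> fejer_weight N 0 = 1"
  by (simp add: fejer_weight_def)

lemma fejer_weight_outside: "int N \<le> \<bar>n\<bar> \<Longrightarrow> fejer_weight N n = 0"
  by (simp add: fejer_weight_def)

lemma fejer_weight_tendsto: "(\<lambda>N. fejer_weight N n) \<longlonglongrightarrow> 1"
proof -
  have "(\<lambda>N. 1 - real (nat \<bar>n\<bar>) * (1 / real N)) \<longlonglongrightarrow> 1 - real (nat \<bar>n\<bar>) * 0"
    by (intro tendsto_intros lim_1_over_n)
  moreover have "\<forall>\<^sub>F N in sequentially. 1 - real (nat \<bar>n\<bar>) * (1 / real N) = fejer_weight N n"
    using eventually_gt_at_top[of "nat \<bar>n\<bar>"]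
    by eventually_elim (simp add: fejer_weight_def of_nat_diff diff_divide_distrib)
  ultimately show ?thesis using Lim_transform_eventually by fastforce
qed

lemma card_differences:
  "card {(k, l). k < N \<and> l < N \<and> int l - int k = n} = N - nat \<bar>n\<bar>"
proof -
  have "{(k, l). k < N \<and> l < N \<and> int l - int k = n} =
      (\<lambda>i. (i + nat (- n), i + nat n)) ` {..<N - nat \<bar>n\<bar>}"
  proof (intro set_eqI iffI)
    fix p assume p: "p \<in> {(k, l). k < N \<and> l < N \<and> int l - int k = n}"
    then show "p \<in> (\<lambda>i. (i + nat (- n), i + nat n)) ` {..<N - nat \<bar>n\<bar>}"
      by (intro image_eqI[of _ _ "fst p - nat (- n)"]) (auto split: prod.splits)
  qed auto
  then show ?thesis by (simp add: card_image inj_on_def)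
qed

lemma sum_cis_powers:
  assumes m: "\<bar>m\<bar> < int M"
  shows "(\<Sum>j<M. cis (2 * pi * real j / real M) powi m) = (if m = 0 then of_nat M else 0)"
proof (cases "m = 0")
  case False
  define w where "w = cis (2 * pi * of_int m / real M)"
  have M: "M > 0" using m by (cases M) auto
  have "cis (2 * pi * real j / real M) powi m = w ^ j" for j
    by (simp add: w_def cis_power_int Complex.DeMoivre mult_ac)
  then have "(\<Sum>j<M. cis (2 * pi * real j / real M) powi m) = (\<Sum>j<M. w ^ j)" by simp
  also have "w \<noteq> 1"
  proof
    assume "w = 1"
    then have "cos (2 * pi * of_int m / real M) = 1" by (metis w_def cis.sel(1) one_complex.sel(1))
    then obtain k :: int where "2 * pi * of_int m / real M = of_int k * 2 * pi"
      using cos_one_2pi_int by blast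
    then have "real_of_int m = real_of_int (k * int M)" using M by (simp add: field_simps)
    then have "m = k * int M" by (simp only: of_int_eq_iff)
    then show False using m False M by (auto simp: abs_mult mult_less_cancel_right2)
  qed
  then have "(\<Sum>j<M. w ^ j) = (w ^ M - 1) / (w - 1)" by (rule geometric_sum)
  also have "w ^ M = 1"
  proof -
    have "w ^ M = cis (2 * pi * of_int m)" using M by (simp add: w_def Complex.DeMoivre)
    then show ?thesis using cis_multiple_2pi[of "of_int m"] by simp
  qed
  finally show ?thesis using False by simp
qed simp

text \<open>
  The Fejer weights are the Fourier coefficients of the nonnegative kernel
  \<open>|1 + z + \<dots> + z\<^sup>N\<^sup>-\<^sup>1|\<^sup>2 / N\<close>. For trigonometric polynomials of bounded degree the integral over
  the circle is an average over roots of unity of sufficiently large order.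
\<close>
lemma fejer_kernel_average:
  assumes nL: "\<bar>n\<bar> \<le> int L" and N: "0 < N" and M: "M = N + L"
  defines "z \<equiv> \<lambda>j. cis (2 * pi * real j / real M)"
  shows "(\<Sum>j<M. of_real ((cmod (\<Sum>k<N. z j ^ k))\<^sup>2) * z j powi n)
    = complex_of_real (real M * real N * fejer_weight N n)"
proof -
  have zc: "cnj (z j) = inverse (z j)" and z0: "z j \<noteq> 0" for j
    by (simp_all add: z_def cis_cnj)
  have "of_real ((cmod (\<Sum>k<N. z j ^ k))\<^sup>2) * z j powi n =
     (\<Sum>k<N. \<Sum>l<N. z j powi (int k - int l + n))" for j
  proof -
    have "of_real ((cmod (\<Sum>k<N. z j ^ k))\<^sup>2) = (\<Sum>k<N. \<Sum>l<N. z j ^ k * cnj (z j) ^ l)"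
      unfolding complex_norm_square by (simp add: sum_product cnj_sum)
    moreover have "z j ^ k * cnj (z j) ^ l * z j powi n = z j powi (int k - int l + n)" for k l
      using z0[of j] by (simp add: zc power_int_add power_int_diff field_simps)
    ultimately show ?thesis by (simp add: sum_distrib_right)
  qed
  then have "(\<Sum>j<M. of_real ((cmod (\<Sum>k<N. z j ^ k))\<^sup>2) * z j powi n)
      = (\<Sum>j<M. \<Sum>k<N. \<Sum>l<N. z j powi (int k - int l + n))" by simp
  also have "\<dots> = (\<Sum>k<N. \<Sum>j<M. \<Sum>l<N. z j powi (int k - int l + n))" by (rule sum.swap)
  also have "\<dots> = (\<Sum>k<N. \<Sum>l<N. \<Sum>j<M. z j powi (int k - int l + n))"
    by (intro sum.cong refl sum.swap)
  also have "\<dots> = (\<Sum>k<N. \<Sum>l<N. if int l - int k = n then of_nat M else 0)"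
  proof (intro sum.cong refl)
    fix k l assume "k \<in> {..<N}" "l \<in> {..<N}"
    then have "\<bar>int k - int l + n\<bar> < int M" using nL M by auto
    then show "(\<Sum>j<M. z j powi (int k - int l + n)) = (if int l - int k = n then of_nat M else 0)"
      unfolding z_def by (subst sum_cis_powers) auto
  qed
  also have "\<dots> = (\<Sum>(k, l)\<in>{..<N} \<times> {..<N}. if int l - int k = n then of_nat M else 0)"
    by (simp add: sum.cartesian_product)
  also have "\<dots> = (\<Sum>p\<in>{(k, l). k < N \<and> l < N \<and> int l - int k = n}. of_nat M)"
    by (rule sum.mono_neutral_cong_right) (auto split: prod.splits)
  also have "\<dots> = of_nat (card {(k, l). k < N \<and> l < N \<and> int l - int k = n}) * of_nat M" by simp
  finally show ?thesis using N by (simp add: card_differences fejer_weight_def)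
qed

context cstar_crossed_product
begin

definition fejer :: "nat \<Rightarrow> (int \<Rightarrow> 'x \<Rightarrow> complex) \<Rightarrow> int \<Rightarrow> 'x \<Rightarrow> complex" where
  "fejer N a = (\<lambda>n x. of_real (fejer_weight N n) * a n x)"

lemma fejer_in: "a \<in> alg_crossed X \<Longrightarrow> fejer N a \<in> alg_crossed X"
  unfolding fejer_def by (rule alg_scale_in)

text \<open>
  A Fejer sum is an average, with nonnegative weights of mean 1, of gauge translates.
\<close>
lemma norm_rep_fejer_le:
  assumes a: "a \<in> alg_crossed X" and N: "0 < N"
  shows "norm (rep (fejer N a)) \<le> norm (rep a)"
proof -
  have fin: "finite {n. a n \<noteq> (\<lambda>_. 0)}" using a alg_crossedD(1) by blast
  \<comment> \<open>L bounds the degrees that occur in a, so roots of unity of order N + L suffice.\<close>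
  define L where "L = (\<Sum>n | a n \<noteq> (\<lambda>_. 0). nat \<bar>n\<bar>)"
  have L: "\<bar>n\<bar> \<le> int L" if "a n \<noteq> (\<lambda>_. 0)" for n
  proof -
    have "nat \<bar>n\<bar> \<le> L" unfolding L_def by (rule member_le_sum) (use that fin in auto)
    then show ?thesis by simp
  qed
  define M where "M = N + L"
  define z where "z = (\<lambda>j. cis (2 * pi * real j / real M))"
  define r where "r = (\<lambda>j. (cmod (\<Sum>k<N. z j ^ k))\<^sup>2)"
  have avg: "(\<Sum>j<M. of_real (r j) * z j powi n) = complex_of_real (real M * real N * fejer_weight N n)"
    if "\<bar>n\<bar> \<le> int L" for n
    unfolding r_def z_def by (rule fejer_kernel_average[OF that N M_def])
  have z1: "cmod (z j) = 1" for j by (simp add: z_def)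
  have in_j: "(\<lambda>n x. of_real (r j) * gauge (z j) a n x) \<in> alg_crossed X" for j
    using alg_scale_in[OF gauge_in[OF a], of "\<lambda>_. of_real (r j)"] by simp
  have "complex_of_real (real M * real N) * fejer N a n x
      = (\<Sum>j<M. of_real (r j) * gauge (z j) a n x)" for n x
  proof (cases "a n = (\<lambda>_. 0)")
    case False
    then have "complex_of_real (real M * real N * fejer_weight N n) * a n x
      = (\<Sum>j<M. of_real (r j) * z j powi n) * a n x" using avg[of n] L by simp
    then show ?thesis by (simp add: fejer_def gauge_def sum_distrib_right mult.assoc)
  qed (simp add: fejer_def gauge_def)
  then have "rep (\<lambda>n x. complex_of_real (real M * real N) * fejer N a n x)
      = rep (\<lambda>n x. \<Sum>j<M. of_real (r j) * gauge (z j) a n x)" by simp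
  then have "scaleC (complex_of_real (real M * real N)) (rep (fejer N a))
      = (\<Sum>j<M. scaleC (of_real (r j)) (rep (gauge (z j) a)))"
    using rep_sum[of "{..<M}" "\<lambda>j n x. of_real (r j) * gauge (z j) a n x", OF in_j]
    by (simp only: rep_scale[OF fejer_in[OF a]] rep_scale[OF gauge_in[OF a]])
  then have "real M * real N * norm (rep (fejer N a))
      = norm (\<Sum>j<M. scaleC (of_real (r j)) (rep (gauge (z j) a)))"
    by (metis norm_scaleC norm_of_real abs_of_nonneg of_nat_0_le_iff mult_nonneg_nonneg)
  also have "\<dots> \<le> (\<Sum>j<M. norm (scaleC (of_real (r j)) (rep (gauge (z j) a))))" by (rule norm_sum)
  also have "\<dots> \<le> (\<Sum>j<M. r j * norm (rep a))"
  proof (rule sum_mono)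
    fix j
    have "0 \<le> r j" by (simp add: r_def)
    then show "norm (scaleC (of_real (r j)) (rep (gauge (z j) a))) \<le> r j * norm (rep a)"
      using norm_rep_gauge_le[OF z1[of j] a] by (simp add: norm_scaleC mult_left_mono)
  qed
  also have "\<dots> = real M * real N * norm (rep a)"
  proof -
    have "complex_of_real (\<Sum>j<M. r j) = complex_of_real (real M * real N)"
      using avg[of 0] N by (simp add: fejer_weight_0)
    then have "(\<Sum>j<M. r j) = real M * real N" by (simp only: of_real_eq_iff)
    then show ?thesis by (simp flip: sum_distrib_right)
  qed
  finally show ?thesis using N by (simp add: M_def)
qed

text \<open>
  The Fejer sum of order 1 keeps only the term of degree 0.
\<close>
lemma norm_coefficient_0_le:
  assumes a: "a \<in> alg_crossed X"
  shows "cmod (a 0 x) \<le> norm (rep a)"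
proof -
  have "fejer 1 a = monomial (a 0) 0"
    by (intro ext) (auto simp: fejer_def fejer_weight_def monomial_def)
  then have "\<iota> (a 0) = rep (fejer 1 a)" by (simp add: rep_monomial)
  then have "norm (\<iota> (a 0)) \<le> norm (rep a)" using norm_rep_fejer_le[OF a, of 1] by simp
  then show ?thesis using norm_iota_ge[OF alg_crossedD(2)[OF a]] order_trans by blast
qed

lemma fejer_tendsto:
  assumes a: "a \<in> alg_crossed X"
  shows "(\<lambda>N. norm (rep (fejer N a) - rep a)) \<longlonglongrightarrow> 0"
proof -
  let ?S = "{n. a n \<noteq> (\<lambda>_. 0)}"
  have "\<exists>B. \<forall>x. cmod (a n x) \<le> B" for n
    using cont_functions_bounded[OF alg_crossedD(2)[OF a]] by metis
  then obtain B where B: "\<And>n x. cmod (a n x) \<le> B n" by metis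
  have bound: "norm (rep (fejer N a) - rep a) \<le> (\<Sum>n\<in>?S. \<bar>fejer_weight N n - 1\<bar> * B n)" for N
  proof -
    have "rep (fejer N a) - rep a = rep (\<lambda>n x. fejer N a n x - a n x)"
      by (rule rep_diff[symmetric]) (intro fejer_in a)+
    also have "norm \<dots> \<le> (\<Sum>n\<in>?S. \<bar>fejer_weight N n - 1\<bar> * B n)"
    proof (rule norm_rep_le)
      show "(\<lambda>n x. fejer N a n x - a n x) \<in> alg_crossed X" by (intro alg_diff_in fejer_in a)
      show "cmod (fejer N a n x - a n x) \<le> \<bar>fejer_weight N n - 1\<bar> * B n" for n x
      proof -
        have "fejer N a n x - a n x = of_real (fejer_weight N n - 1) * a n x"
          by (simp add: fejer_def algebra_simps)
        then show ?thesis using B[of n x] by (simp only: norm_mult norm_of_real mult_left_mono abs_ge_zero)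
      qed
    qed (auto simp: alg_crossedD(1)[OF a] fejer_def)
    finally show ?thesis .
  qed
  have "(\<lambda>N. \<Sum>n\<in>?S. \<bar>fejer_weight N n - 1\<bar> * B n) \<longlonglongrightarrow> (\<Sum>n\<in>?S. \<bar>1 - 1\<bar> * B n)"
    by (intro tendsto_intros fejer_weight_tendsto)
  then have lim: "(\<lambda>N. \<Sum>n\<in>?S. \<bar>fejer_weight N n - 1\<bar> * B n) \<longlonglongrightarrow> 0" by simp
  show ?thesis
    by (rule Lim_null_comparison[OF always_eventually lim]) (use bound in simp)
qed

text \<open>
  Fix a finite sum near y and an order N for which its Fejer sum is still near y. As Fejer sums do
  not increase distances, the N-th Fejer sum of every s near y has norm at least half that of y. It
  has only about 2 N terms, whatever the degree of s, so some coefficient of s is large.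
\<close>
lemma nonzero_has_large_coefficient:
  assumes y: "y \<noteq> 0"
  obtains \<kappa> \<epsilon> where "0 < \<kappa>" "0 < \<epsilon>"
    "\<And>s. s \<in> alg_crossed X \<Longrightarrow> norm (rep s - y) < \<epsilon> \<Longrightarrow> \<exists>n. \<exists>x\<in>topspace X. \<kappa> \<le> cmod (s n x)"
proof -
  define \<eta> where "\<eta> = norm y"
  have \<eta>: "\<eta> > 0" using y by (simp add: \<eta>_def)
  obtain s0 where s0: "s0 \<in> alg_crossed X" "norm (rep s0 - y) < \<eta> / 8"
    using rep_dense[of "\<eta> / 8" y] \<eta> by auto
  have "\<forall>\<^sub>F N in sequentially. norm (rep (fejer N s0) - rep s0) < \<eta> / 8"
    using order_tendstoD(2)[OF fejer_tendsto[OF s0(1)], of "\<eta> / 8"] \<eta> by simp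
  then have "\<forall>\<^sub>F N in sequentially. 0 < N \<and> norm (rep (fejer N s0) - rep s0) < \<eta> / 8"
    by (intro eventually_conj eventually_gt_at_top)
  then obtain N where N: "0 < N" "norm (rep (fejer N s0) - rep s0) < \<eta> / 8"
    by (auto simp: eventually_sequentially)
  define \<kappa> where "\<kappa> = \<eta> / (4 * (2 * real N + 1))"
  have \<kappa>: "\<kappa> > 0" using \<eta> by (simp add: \<kappa>_def)
  have "\<exists>n. \<exists>x\<in>topspace X. \<kappa> \<le> cmod (s n x)"
    if s: "s \<in> alg_crossed X" and sy: "norm (rep s - y) < \<eta> / 8" for s
  proof (rule ccontr)
    assume neg: "\<not> ?thesis"
    have small: "cmod (s n x) \<le> \<kappa>" for n x
    proof (cases "x \<in> topspace X")
      case True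
      then have "\<not> \<kappa> \<le> cmod (s n x)" using neg by blast
      then show ?thesis by simp
    next
      case False then show ?thesis using cont_functions_outside[OF alg_crossedD(2)[OF s]] \<kappa> by simp
    qed
    have "norm (rep (fejer N s)) \<le> (\<Sum>n\<in>{- int N..int N}. \<kappa>)"
    proof (rule norm_rep_le[OF fejer_in[OF s]])
      show "cmod (fejer N s n x) \<le> \<kappa>" for n x
        using mult_mono[OF fejer_weight_bounds(2)[of N n] small[of n x]] fejer_weight_bounds(1)[of N n]
        by (simp add: fejer_def norm_mult)
      show "{n. fejer N s n \<noteq> (\<lambda>_. 0)} \<subseteq> {- int N..int N}"
      proof
        fix n assume "n \<in> {n. fejer N s n \<noteq> (\<lambda>_. 0)}"
        then have "fejer_weight N n \<noteq> 0" by (auto simp: fejer_def)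
        then have "\<bar>n\<bar> < int N" using fejer_weight_outside[of N n] by force
        then show "n \<in> {- int N..int N}" by auto
      qed
    qed auto
    also have "\<dots> = \<eta> / 4" by (simp add: \<kappa>_def field_simps)
    finally have up: "norm (rep (fejer N s)) \<le> \<eta> / 4" .
    have "norm (rep (fejer N s) - rep (fejer N s0)) = norm (rep (fejer N (\<lambda>n x. s n x - s0 n x)))"
      unfolding rep_diff[OF fejer_in[OF s] fejer_in[OF s0(1)], symmetric]
      by (simp add: fejer_def right_diff_distrib)
    also have "\<dots> \<le> norm (rep (\<lambda>n x. s n x - s0 n x))"
      by (intro norm_rep_fejer_le alg_diff_in s s0 N)
    also have "\<dots> = norm ((rep s - y) - (rep s0 - y))" by (simp add: rep_diff s s0)
    also have "\<dots> \<le> norm (rep s - y) + norm (rep s0 - y)" by (rule norm_triangle_ineq4)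
    finally have "norm (rep (fejer N s) - rep (fejer N s0)) < \<eta> / 4" using sy s0(2) by linarith
    moreover have "norm y \<le> norm (rep (fejer N s)) + norm (rep (fejer N s) - rep (fejer N s0))
        + norm (rep (fejer N s0) - rep s0) + norm (rep s0 - y)"
      by (smt (verit, ccfv_threshold) norm_triangle_sub norm_minus_commute norm_triangle_ineq2)
    ultimately show False using up N(2) s0(2) \<eta> unfolding \<eta>_def by linarith
  qed
  then show thesis using that[of \<kappa> "\<eta> / 8"] \<kappa> \<eta> by auto
qed

text \<open>
  The coefficient \<open>g \<cdot> c(n) \<cdot> \<alpha>\<^sup>n(g)\<close> is nonzero only at points of V that \<open>\<sigma>\<^sup>-\<^sup>n\<close> maps into V,
  and by hypothesis such points are fixed by \<open>\<sigma>\<^sup>-\<^sup>n\<close>. On them f and \<open>\<alpha>\<^sup>n(f)\<close> agree, so the term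
  of degree n commutes with f.
\<close>
lemma compression_in_commutant:
  assumes c: "c \<in> alg_crossed X" and g: "g \<in> cont_functions X"
    and V: "\<And>y. y \<notin> V \<Longrightarrow> g y = 0"
    and fix_or_move: "\<And>n. c n \<noteq> (\<lambda>_. 0) \<Longrightarrow>
      (\<forall>y\<in>V. hp (- n) y = y) \<or> (\<forall>y\<in>V. hp (- n) y \<notin> V)"
  defines "d \<equiv> \<lambda>n y. g y * c n y * alpha_power X \<sigma> n g y"
  shows "d \<in> alg_crossed X" "rep d = \<iota> g * rep c * \<iota> g" "rep d \<in> commutant (\<iota> ` cont_functions X)"
proof -
  let ?S = "{n. c n \<noteq> (\<lambda>_. 0)}"
  have S: "finite ?S" using c alg_crossedD(1) by blast
  have cC: "c n \<in> cont_functions X" for n using c alg_crossedD(2) by blast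
  have dC: "d n \<in> cont_functions X" for n
    unfolding d_def by (intro cont_functions_mult g cC alpha_power_in)
  show "d \<in> alg_crossed X" by (rule alg_crossedI[OF S]) (auto simp: d_def dC[unfolded d_def])
  have rep_d: "rep d = (\<Sum>n\<in>?S. \<iota> (d n) * up n)" by (rule rep_eq[OF S]) (auto simp: d_def)
  have "\<iota> (d n) * up n = \<iota> g * (\<iota> (c n) * up n) * \<iota> g" for n
  proof -
    have "\<iota> (d n) = \<iota> g * \<iota> (c n) * \<iota> (alpha_power X \<sigma> n g)"
      by (simp add: d_def iota_mult g cC alpha_power_in cont_functions_mult)
    then show ?thesis by (simp add: mult.assoc unitary_power_covariant[OF g])
  qed
  then show "rep d = \<iota> g * rep c * \<iota> g"
    unfolding rep_d by (simp add: rep_def sum_distrib_left sum_distrib_right)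
  have "rep d * \<iota> f = \<iota> f * rep d" if f: "f \<in> cont_functions X" for f
  proof -
    have "d n y * alpha_power X \<sigma> n f y = f y * d n y" if "n \<in> ?S" for n y
    proof (cases "d n y = 0")
      case False
      then have "g y \<noteq> 0" "alpha_power X \<sigma> n g y \<noteq> 0" by (auto simp: d_def)
      then have "y \<in> topspace X" "y \<in> V" "hp (- n) y \<in> V"
        using V by (auto simp: alpha_power_def split: if_splits)
      then have "alpha_power X \<sigma> n f y = f y"
        using fix_or_move[of n] that by (auto simp: alpha_power_def)
      then show ?thesis by simp
    qed simp
    then have eq: "(\<lambda>y. d n y * alpha_power X \<sigma> n f y) = (\<lambda>y. f y * d n y)" if "n \<in> ?S" for n
      using that by blast
    have "\<iota> (d n) * up n * \<iota> f = \<iota> f * (\<iota> (d n) * up n)" if n: "n \<in> ?S" for n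
    proof -
      have "\<iota> (d n) * up n * \<iota> f = \<iota> (\<lambda>y. d n y * alpha_power X \<sigma> n f y) * up n"
        by (simp add: iota_mult dC alpha_power_in f mult.assoc unitary_power_covariant[OF f])
      also have "\<dots> = \<iota> f * (\<iota> (d n) * up n)"
        unfolding eq[OF n] by (simp add: iota_mult dC f mult.assoc)
      finally show ?thesis .
    qed
    then show ?thesis unfolding rep_d by (simp add: sum_distrib_left sum_distrib_right)
  qed
  then show "rep d \<in> commutant (\<iota> ` cont_functions X)" by (auto simp: commutant_def)
qed

end

section \<open>The intersection property\<close>

lemma star_mult_self_continuous:
  assumes "0 < e"
  obtains \<eta> where "0 < \<eta>"
    "\<And>u. norm (u - t) < \<eta> \<Longrightarrow> norm (star u * u - star t * (t :: 'a::cstar_algebra)) < e"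
proof -
  have "isCont (\<lambda>u. star u * u) t"
    by (intro isCont_mult bounded_linear.isCont[OF bounded_linear_star] continuous_ident)
  then have "\<exists>d>0. \<forall>u. dist u t < d \<longrightarrow> dist (star u * u) (star t * t) < e"
    using assms by (simp add: continuous_at_eps_delta)
  then show thesis using that by (auto simp: dist_norm)
qed

context cstar_crossed_product
begin

text \<open>
  Positivity of E: the coefficient of degree 0 of \<open>r\<^sup>* r\<close> is nonnegative for finite sums r, and
  finite sums r near t make \<open>r\<^sup>* r\<close> as close to \<open>\<mu> - d\<close> as desired.
\<close>
lemma Re_coefficient_0_le:
  assumes t: "star t = t" and d: "d \<in> alg_crossed X" and eq: "\<mu> *\<^sub>R 1 - rep d = t * t"
    and x: "x \<in> topspace X"
  shows "Re (d 0 x) \<le> \<mu>"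
proof (rule field_le_epsilon)
  fix e :: real assume e: "0 < e"
  define m where "m = (\<lambda>n y. complex_of_real \<mu> * monomial (indicator (topspace X)) 0 n y)"
  have m: "m \<in> alg_crossed X"
    unfolding m_def using alg_scale_in[OF monomial_in[OF cont_functions_indicator], of "\<lambda>_. complex_of_real \<mu>" 0] by simp
  have rep_m: "rep m = \<mu> *\<^sub>R 1"
    unfolding m_def rep_scale[OF monomial_in[OF cont_functions_indicator]] by (simp add: rep_monomial iota_one scaleC_of_real)
  obtain \<eta> where \<eta>: "\<eta> > 0" "\<And>u. norm (u - t) < \<eta> \<Longrightarrow> norm (star u * u - star t * t) < e"
    using star_mult_self_continuous[OF e] by metis
  obtain r where r: "r \<in> alg_crossed X" "norm (rep r - t) < \<eta>" using rep_dense[OF \<eta>(1)] by metis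
  let ?q = "alg_mult X \<sigma> (alg_star X \<sigma> r) r"
  have q: "?q \<in> alg_crossed X" by (intro alg_mult_in alg_star_in r)
  have q0: "0 \<le> Re (?q 0 x)" unfolding alg_star_mult_self_0[OF r(1) x] by (simp add: sum_nonneg)
  let ?w = "\<lambda>n y. (?q n y + d n y) - m n y"
  have w: "?w \<in> alg_crossed X" by (intro alg_diff_in alg_add_in q d m)
  have "rep ?w = star (rep r) * rep r - (\<mu> *\<^sub>R 1 - rep d)"
    using rep_diff[OF alg_add_in[OF q d] m] rep_add[OF q d]
    by (simp add: rep_m rep_mult rep_star alg_star_in r)
  also have "\<dots> = star (rep r) * rep r - star t * t" by (simp add: eq t)
  finally have "norm (rep ?w) < e" using \<eta>(2)[OF r(2)] by simp
  then have "cmod (?w 0 x) < e" using norm_coefficient_0_le[OF w, of x] by linarith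
  then have "Re (?w 0 x) < e" using complex_Re_le_cmod[of "?w 0 x"] by linarith
  moreover have "m 0 x = of_real \<mu>" using x by (simp add: m_def monomial_def)
  ultimately show "Re (d 0 x) \<le> \<mu> + e" using q0 by simp
qed

text \<open>
  The order of the choices matters: the lower bound for the coefficients depends only on a, so
  \<open>\<mu>\<close> is fixed before s, and s can be taken so close to a that the error stays below \<open>\<mu>\<close>.
\<close>
lemma ideal_meets_commutant:
  assumes J: "two_sided_ideal J" and J0: "J \<noteq> {0}"
  shows "J \<inter> commutant (\<iota> ` cont_functions X) \<noteq> {0}"
proof -
  have ideal: "u * v \<in> J" "v * u \<in> J" if "v \<in> J" for u v
    using J that by (auto simp: two_sided_ideal_def)
  have "0 \<in> J" using J by (simp add: two_sided_ideal_def)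
  then obtain a0 where a0: "a0 \<in> J" "a0 \<noteq> 0" using J0 by blast
  \<comment> \<open>The norm 1/2 ensures \<open>\<parallel>d - \<mu>\<parallel> \<le> 1\<close> below.\<close>
  define a where "a = (1 / (2 * norm a0)) *\<^sub>R a0"
  have "a = ((1 / (2 * norm a0)) *\<^sub>R 1) * a0" by (simp add: a_def)
  then have aJ: "a \<in> J" using ideal(1)[OF a0(1)] by metis
  have na: "norm a = 1 / 2" and anz: "a \<noteq> 0" using a0(2) by (simp_all add: a_def)
  obtain \<kappa> \<epsilon> where \<kappa>: "0 < \<kappa>" and \<epsilon>: "0 < \<epsilon>" and large:
    "\<And>s. s \<in> alg_crossed X \<Longrightarrow> norm (rep s - a) < \<epsilon> \<Longrightarrow> \<exists>n. \<exists>x\<in>topspace X. \<kappa> \<le> cmod (s n x)"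
    using nonzero_has_large_coefficient[OF anz] by metis
  define \<mu> where "\<mu> = min (1 / 4) (\<kappa>\<^sup>2 / 2)"
  have \<mu>: "0 < \<mu>" "\<mu> \<le> 1 / 4" "\<mu> < \<kappa>\<^sup>2" using \<kappa> by (auto simp: \<mu>_def min_def field_simps)
  obtain \<eta> where \<eta>: "\<eta> > 0" "\<And>u. norm (u - a) < \<eta> \<Longrightarrow> norm (star u * u - star a * a) < \<mu>"
    using star_mult_self_continuous[OF \<mu>(1)] by metis
  obtain s where s: "s \<in> alg_crossed X" "norm (rep s - a) < min \<epsilon> \<eta>"
    using rep_dense[of "min \<epsilon> \<eta>" a] \<epsilon> \<eta>(1) by auto
  have close: "norm (star (rep s) * rep s - star a * a) < \<mu>" using \<eta>(2) s(2) by simp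
  define c where "c = alg_mult X \<sigma> (alg_star X \<sigma> s) s"
  have c: "c \<in> alg_crossed X" unfolding c_def by (intro alg_mult_in alg_star_in s)
  have rep_c: "rep c = star (rep s) * rep s" by (simp add: c_def rep_mult rep_star alg_star_in s)
  obtain n x0 where nx: "x0 \<in> topspace X" "\<kappa> \<le> cmod (s n x0)" using large[OF s(1)] s(2) by auto
  \<comment> \<open>By \<open>alg_star_mult_self_0\<close>, the coefficient n of s at x0 contributes to E(c) at \<open>\<sigma>\<^sup>-\<^sup>n x0\<close>.\<close>
  define x1 where "x1 = hp (- n) x0"
  have x1: "x1 \<in> topspace X" "hp n x1 = x0" using nx(1) by (simp_all add: x1_def)
  have "\<mu> < Re (c 0 x1)"
  proof -
    have "\<kappa>\<^sup>2 \<le> (cmod (s n (hp n x1)))\<^sup>2" using nx(2) \<kappa> by (simp add: x1 power_mono)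
    also have "\<dots> \<le> (\<Sum>k | s k \<noteq> (\<lambda>_. 0). (cmod (s k (hp k x1)))\<^sup>2)"
    proof (rule member_le_sum)
      show "n \<in> {k. s k \<noteq> (\<lambda>_. 0)}" using nx(2) \<kappa> by auto
    qed (use alg_crossedD(1)[OF s(1)] in auto)
    also have "\<dots> = Re (c 0 x1)" unfolding c_def alg_star_mult_self_0[OF s(1) x1(1)] by simp
    finally show ?thesis using \<mu>(3) by simp
  qed
  define W where "W = {y \<in> topspace X. c 0 y \<in> {z. \<mu> < Re z}}"
  have "open {z. \<mu> < Re z}" by (intro open_Collect_less continuous_intros)
  then have W: "openin X W"
    unfolding W_def
    by (intro openin_continuous_map_preimage[OF cont_functions_continuous[OF alg_crossedD(2)[OF c]]]) simp
  have W0: "W \<noteq> {}" using x1(1) \<open>\<mu> < Re (c 0 x1)\<close> by (auto simp: W_def)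
  have "finite (uminus ` {k. c k \<noteq> (\<lambda>_. 0)})" using alg_crossedD(1)[OF c] by blast
  from open_set_fixed_or_displaced[OF this W W0]
  obtain V where V: "openin X V" "V \<noteq> {}" "V \<subseteq> W"
    and move: "\<And>k. k \<in> uminus ` {k. c k \<noteq> (\<lambda>_. 0)} \<Longrightarrow>
      (\<forall>y\<in>V. hp k y = y) \<or> (\<forall>y\<in>V. hp k y \<notin> V)"
    by blast
  obtain x where x: "x \<in> V" using V(2) by blast
  then have xX: "x \<in> topspace X" and cx: "\<mu> < Re (c 0 x)" using V(3) by (auto simp: W_def)
  obtain g where g: "(\<lambda>y. complex_of_real (g y)) \<in> cont_functions X" "g x = 1"
    "\<And>y. 0 \<le> g y \<and> g y \<le> 1" "\<And>y. y \<notin> V \<Longrightarrow> g y = 0"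
    using urysohn_bump[OF V(1) x] by blast
  let ?g = "\<lambda>y. complex_of_real (g y)"
  define d where "d = (\<lambda>n y. ?g y * c n y * alpha_power X \<sigma> n ?g y)"
  have d: "d \<in> alg_crossed X" and rep_d: "rep d = \<iota> ?g * rep c * \<iota> ?g"
    and d_comm: "rep d \<in> commutant (\<iota> ` cont_functions X)"
    unfolding d_def
    by (rule compression_in_commutant[OF c g(1), of V]; use g(4) move in auto)+
  have ng: "norm (\<iota> ?g) \<le> 1" by (rule norm_iota_le_1[OF g(1)]) (use g(3) in auto)
  have sg: "star (\<iota> ?g) = \<iota> ?g" using iota_star[OF g(1)] by simp
  have compress: "norm (\<iota> ?g * u * \<iota> ?g) \<le> norm u" for u
  proof -
    have "norm (\<iota> ?g * u * \<iota> ?g) \<le> norm (\<iota> ?g) * norm u * norm (\<iota> ?g)"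
      by (meson norm_mult_ineq mult_right_mono norm_ge_zero order_trans)
    also have "\<dots> \<le> 1 * norm u * 1" using ng by (intro mult_mono) auto
    finally show ?thesis by simp
  qed
  define j where "j = \<iota> ?g * (star a * a) * \<iota> ?g"
  have jJ: "j \<in> J" unfolding j_def by (intro ideal aJ)
  have "j - rep d = \<iota> ?g * (star a * a - rep c) * \<iota> ?g"
    by (simp add: j_def rep_d left_diff_distrib right_diff_distrib)
  then have jd: "norm (j - rep d) < \<mu>"
    using compress[of "star a * a - rep c"] close by (simp add: rep_c norm_minus_commute)
  have sd: "star (rep d) = rep d" by (simp add: rep_d rep_c star_mult star_star sg mult.assoc)
  have dm: "norm (rep d - \<mu> *\<^sub>R 1) \<le> 1"
  proof -
    have "norm (rep d) \<le> norm (rep c)" unfolding rep_d by (rule compress)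
    also have "\<dots> \<le> norm (star a * a) + norm (rep c - star a * a)" by (rule norm_triangle_sub)
    also have "\<dots> \<le> 1 / 4 + \<mu>" using close by (simp add: rep_c cstar_identity na power2_eq_square)
    finally have "norm (rep d) \<le> 1 / 2" using \<mu>(2) by simp
    moreover have "norm (\<mu> *\<^sub>R (1::'a)) \<le> \<mu>" using \<mu>(1) norm_one_le[where 'a = 'a] by (simp add: mult_left_le)
    ultimately show ?thesis using norm_triangle_ineq4[of "rep d" "\<mu> *\<^sub>R 1"] \<mu>(2) by linarith
  qed
  obtain h where h: "h \<in> J" "\<And>b. rep d * b = b * rep d \<Longrightarrow> h * b = b * h"
    "h = 0 \<Longrightarrow> \<exists>t. star t = t \<and> \<mu> *\<^sub>R 1 - rep d = t * t"
    using ideal_contains_positive_part[OF J jJ sd dm jd] by blast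
  have "h \<noteq> 0"
  proof
    assume "h = 0"
    then obtain t where "star t = t" "\<mu> *\<^sub>R 1 - rep d = t * t" using h(3) by blast
    then have "Re (d 0 x) \<le> \<mu>" using Re_coefficient_0_le[OF _ d _ xX] by blast
    moreover have "d 0 x = c 0 x" using g(2) xX by (simp add: d_def alpha_power_def)
    ultimately show False using cx by simp
  qed
  moreover have "h \<in> commutant (\<iota> ` cont_functions X)"
    using d_comm h(2) by (auto simp: commutant_def)
  ultimately show ?thesis using h(1) by blast
qed

end

theorem corollary4p4:
  fixes X :: "'x topology" and \<sigma> :: "'x \<Rightarrow> 'x"
    and \<iota> :: "('x \<Rightarrow> complex) \<Rightarrow> 'a::cstar_algebra" and \<delta> :: 'a
  assumes "topological_dynamical_system X \<sigma>"
    and "cstar_crossed_product X \<sigma> \<iota> \<delta>"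
  shows "ideal_intersection_property (commutant (\<iota> ` cont_functions X))"
  unfolding ideal_intersection_property_def
  using cstar_crossed_product.ideal_meets_commutant[OF assms(2)] by blast

end
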